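(* Assume that $\mathbb{X}$ is locally $\sigma$-compact. Let $p\in[1,\infty)$, $0\le s<t\le T$, $0\le u_1<u_2\le T$, and let $f\in\mathcal{L}_0(\overline\Omega_T,\Sigma^0_T,\overline{\mathbb{P}}_T;C(\mathbb{X}))$ be such that $\int_{\overline\Omega_T}\sup_{x\in K}|f(x)|\,d\overline{\mathbb{P}}_T<\infty$ for every compact $K\subseteq\mathbb{X}$. If $\left\|\int_{u_1}^{u_2}\sup_{x\in\mathbb{X}}|f(r,x)-(\mathbb{E}^{\overline{\mathcal{H}_s^t}}f)(r,x)|dr\right\|_{L_p(\overline\Omega)}<\infty$, then $\overline{\mathbb{P}}$-a.s. $$\mathbb{E}^{\overline{\mathcal{G}_s^t}}\Big(\int_{u_1}^{u_2}\sup_{x\in\mathbb{X}}|f(r,x)-f^{(s,t]}(r,x)|dr\Big)^p\le2^p\,\mathbb{E}^{\overline{\mathcal{G}_s^t}}\Big(\int_{u_1}^{u_2}\sup_{x\in\mathbb{X}}|f(r,x)-(\mathbb{E}^{\overline{\mathcal{H}_s^t}}f)(r,x)|dr\Big)^p.$$ Conversely, if $\left\|\int_{u_1}^{u_2}\sup_{x\in\mathbb{X}}|f(r,x)-f^{(s,t]}(r,x)|dr\right\|_{L_p(\overline\Omega)}<\infty$, then $\overline{\mathbb{P}}$-a.s. $$\mathbb{E}^{\overline{\mathcal{G}_s^t}}\Big(\int_{u_1}^{u_2}\sup_{x\in\mathbb{X}}|f(r,x)-(\mathbb{E}^{\overline{\mathcal{H}_s^t}}f)(r,x)|dr\Bi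g)^p\le\mathbb{E}^{\overline{\mathcal{G}_s^t}}\Big(\int_{u_1}^{u_2}\sup_{x\in\mathbb{X}}|f(r,x)-f^{(s,t]}(r,x)|dr\Big)^p.$$
   Context: A complete metric space $\mathbb{X}\ne\emptyset$ is locally $\sigma$-compact if there are compact sets $\emptyset\ne K_1\subseteq K_2\subseteq\dots$ with $\overline{\mathring K_n}=K_n$ and $\mathbb{X}=\bigcup_n\mathring K_n$. Fix $T>0$, $d\ge1$. $(\Omega,\mathcal{F},\mathbb{P})$ is a complete probability space with a $d$-dimensional Brownian motion $W$ with continuous paths and its augmented natural filtration $(\mathcal{F}_t)_{t\in[0,T]}$, $\mathcal{F}=\mathcal{F}_T$; $(\Omega',\mathcal{F}',\mathbb{P}',(\mathcal{F}'_t))$, $W'$ is another such basis. Put $\overline\Omega=\Omega\times\Omega'$, $\overline{\mathbb{P}}=\mathbb{P}\times\mathbb{P}'$, $\overline{\mathcal{F}}$ the $\overline{\mathbb{P}}$-completion of $\mathcal{F}\otimes\mathcal{F}'$; $W^0(\omega,\omega')=W(\omega)$, $W^1(\omega,\omega')=W'(\omega')$. For $0\le s<t\le T$ let $W^{(s,t]}_r=\int_0^r(1-\chi_{(s,t]}(v))dW^0_v+\int_0^r\chi_{(s,t]}(v)dW^1_v$. $\mathcal{F}^0$ and $\mathcal{F}^{(s,t]}$ are the $\overline{\mathbb{P}}$-augmented $\sigma$-algebras generated by $W^0$ and $W^{(s,t]}$ on $[0,T]$. $\overline\Omega_T=[0,T]\times\overline\Omega$, $\overline{\mathbb{P}}_T=\frac{\lambda}{T}\otimes\overline{\mathbb{P}}$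 ($\lambda$ Lebesgue measure), $\Sigma_T^0=\mathcal{B}([0,T])\otimes\mathcal{F}^0$, $\Sigma_T^{(s,t]}=\mathcal{B}([0,T])\otimes\mathcal{F}^{(s,t]}$. $\mathcal{L}_0(\overline\Omega_T,\Sigma,\overline{\mathbb{P}}_T;C(\mathbb{X}))$ is the set of $f:\overline\Omega_T\times\mathbb{X}\to\mathbb{R}$ with $f(\cdot,x)$ $\Sigma$-measurable for all $x$ and $f(\eta,\cdot)$ continuous for all $\eta$; $L_0(\dots)$ is the set of equivalence classes, where $f,g$ are identified if $f(\eta,\cdot)=g(\eta,\cdot)$ for $\overline{\mathbb{P}}_T$-a.e. $\eta$. Decoupling: let $(h_k)$ be the $L_2([0,T])$-normalized Haar functions, $J=(\int_0^Th_k\,dW^0_{\cdot,i})_{k\in\mathbb{N},i\le d}:\overline\Omega\to\mathbb{R}^{\mathbb{N}}$ and $J^{(s,t]}$ the same with $W^{(s,t]}$. A $\Sigma_T^0$-measurable $X$ can be written $X(r,\eta)=\hat X(r,J(\eta))$ $\overline{\mathbb{P}}_T$-a.e. with $\hat X$ measurable, and $X^{(s,t]}\in L_0(\overline\Omega_T,\Sigma_T^{(s,t]},\overline{\mathbb{P}}_T)$ is the (well-defined) class of $\hat X(r,J^{(s,t]}(\eta))$. For $f\in\mathcal{L}_0(\overline\Omega_T,\Sigma_T^0,\overline{\mathbb{P}}_T;C(\mathbb{X}))$, $f^{(s,t]}\in L_0(\overline\Omega_T,\Sigma_T^{(s,t]},\overline{\mathbb{P}}_T;C(\mathbb{X}))$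 is the continuous modification of $(f(x)^{(s,t]})_{x\in\mathbb{X}}$. Let $\overline{\mathcal{G}_s^t}:=\sigma(W^0_r,r\in[0,s])\vee\sigma(W_r^0-W_t^0,r\in[t,T])\vee\overline{\mathcal{N}}$ with $\overline{\mathcal{N}}$ the $\overline{\mathbb{P}}$-nullsets, $\overline{\mathcal{H}_s^t}:=\mathcal{B}([0,T])\otimes\overline{\mathcal{G}_s^t}$. $\mathbb{E}^{\overline{\mathcal{G}_s^t}}$ is conditional expectation under $\overline{\mathbb{P}}$. $\mathbb{E}^{\overline{\mathcal{H}_s^t}}f\in\mathcal{L}_0(\overline\Omega_T,\overline{\mathcal{H}_s^t},\overline{\mathbb{P}}_T;C(\mathbb{X}))$ is the (unique up to indistinguishability) process, continuous in $x$, with $(\mathbb{E}^{\overline{\mathcal{H}_s^t}}f)(x)=\mathbb{E}^{\overline{\mathcal{H}_s^t}}(f(x))$ $\overline{\mathbb{P}}_T$-a.s. for each $x\in\mathbb{X}$ (conditional expectation under $\overline{\mathbb{P}}_T$). *)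

theory Defs
  imports "HOL-Probability.Probability" "HOL-Library.Discrete_Functions"
begin

definition locally_sigma_compact :: "'x::complete_space itself \<Rightarrow> bool" where
  "locally_sigma_compact _ \<longleftrightarrow>
     (\<exists>K :: nat \<Rightarrow> 'x set.
        (\<forall>n. compact (K n) \<and> K n \<noteq> {} \<and> K n \<subseteq> K (Suc n) \<and> closure (interior (K n)) = K n) \<and>
        (\<Union>n. interior (K n)) = UNIV)"

definition enn_powr :: "ennreal \<Rightarrow> real \<Rightarrow> ennreal" where
  "enn_powr a p = (if a = \<infinity> then \<infinity> else ennreal (enn2real a powr p))"

definition enn_Lp_norm :: "real \<Rightarrow> 'o measure \<Rightarrow> ('o \<Rightarrow> ennreal) \<Rightarrow> ennreal" where
  "enn_Lp_norm p N g = enn_powr (\<integral>\<^sup>+ \<eta>. enn_powr (g \<eta>) p \<partial>N) (1 / p)"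

text \<open>The \<open>N\<close>-augmented \<open>\<sigma>\<close>-algebra generated by a family of random vectors. As for every
  measure introduced below solely as a \<open>\<sigma>\<close>-algebra, only its space and its measurable sets
  matter.\<close>

definition aug_sigma :: "'o measure \<Rightarrow> ('o \<Rightarrow> 'v::topological_space) set \<Rightarrow> 'o measure" where
  "aug_sigma N XS =
     sigma (space N) ({X -` B \<inter> space N | X B. X \<in> XS \<and> B \<in> sets borel} \<union> null_sets N)"

text \<open>The product of normal densities expresses that \<open>W\<^sub>v - W\<^sub>u\<close> has law \<open>N(0, (v - u) I\<^sub>d)\<close>.\<close>

definition brownian_motion :: "real \<Rightarrow> 'o measure \<Rightarrow> (real \<Rightarrow> 'o \<Rightarrow> real ^ 'd) \<Rightarrow> bool" where
  "brownian_motion T N W \<longleftrightarrow>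
     (\<forall>r\<in>{0..T}. W r \<in> borel_measurable N) \<and>
     (AE \<omega> in N. W 0 \<omega> = 0) \<and>
     (\<forall>\<omega>\<in>space N. continuous_on {0..T} (\<lambda>r. W r \<omega>)) \<and>
     (\<forall>u v. 0 \<le> u \<and> u < v \<and> v \<le> T \<longrightarrow>
        distributed N lborel (\<lambda>\<omega>. W v \<omega> - W u \<omega>)
          (\<lambda>x. ennreal (\<Prod>i\<in>UNIV. normal_density 0 (sqrt (v - u)) (x $ i)))) \<and>
     (\<forall>(n::nat) \<tau>. mono \<tau> \<and> range \<tau> \<subseteq> {0..T} \<longrightarrow>
        prob_space.indep_vars N (\<lambda>_. borel) (\<lambda>k \<omega>. W (\<tau> (Suc k)) \<omega> - W (\<tau> k) \<omega>) {..<n})"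

text \<open>The last conjunct says \<open>\<F> = \<F>\<^sub>T\<close> for the augmented natural filtration of \<open>W\<close>.\<close>

definition brownian_basis :: "real \<Rightarrow> 'o measure \<Rightarrow> (real \<Rightarrow> 'o \<Rightarrow> real ^ 'd) \<Rightarrow> bool" where
  "brownian_basis T N W \<longleftrightarrow>
     prob_space N \<and> complete_measure N \<and> brownian_motion T N W \<and>
     sets N = sets (aug_sigma N (W ` {0..T}))"

definition Omega_bar :: "'a measure \<Rightarrow> 'b measure \<Rightarrow> ('a \<times> 'b) measure" where
  "Omega_bar M M' = completion (M \<Otimes>\<^sub>M M')"

definition W0 :: "(real \<Rightarrow> 'a \<Rightarrow> 'v) \<Rightarrow> real \<Rightarrow> 'a \<times> 'b \<Rightarrow> 'v" where
  "W0 W r \<eta> = W r (fst \<eta>)"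

definition W1 :: "(real \<Rightarrow> 'b \<Rightarrow> 'v) \<Rightarrow> real \<Rightarrow> 'a \<times> 'b \<Rightarrow> 'v" where
  "W1 W' r \<eta> = W' r (snd \<eta>)"

text \<open>A list of triples \<open>(a, u, v)\<close> represents the deterministic step function that is the sum of
  the \<open>a \<chi>\<^bsub>(u,v]\<^esub>\<close>. All integrands needed here are of this form, and \<open>step_integral \<phi> B r\<close> is
  the stochastic integral of \<open>\<phi>\<close> against \<open>B\<close> over \<open>(0, r]\<close>.\<close>

definition step_fun :: "(real \<times> real \<times> real) list \<Rightarrow> real \<Rightarrow> real" where
  "step_fun \<phi> r = (\<Sum>(a, u, v)\<leftarrow>\<phi>. a * indicator {u<..v} r)"

definition step_integral ::
  "(real \<times> real \<times> real) list \<Rightarrow> (real \<Rightarrow> 'o \<Rightarrow> 'v::real_vector) \<Rightarrow> real \<Rightarrow> 'o \<Rightarrow> 'v" where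
  "step_integral \<phi> B r \<eta> = (\<Sum>(a, u, v)\<leftarrow>\<phi>. a *\<^sub>R (B (min v r) \<eta> - B (min u r) \<eta>))"

definition outside_steps :: "real \<Rightarrow> real \<Rightarrow> real \<Rightarrow> (real \<times> real \<times> real) list" where
  "outside_steps T s t = [(1, 0, s), (1, t, T)]"

definition inside_steps :: "real \<Rightarrow> real \<Rightarrow> (real \<times> real \<times> real) list" where
  "inside_steps s t = [(1, s, t)]"

lemma step_fun_outside_steps:
  assumes "0 \<le> s" "s < t" "t \<le> T" "r \<in> {0<..T}"
  shows "step_fun (outside_steps T s t) r = 1 - indicator {s<..t} r"
  using assms by (auto simp: step_fun_def outside_steps_def indicator_def)

lemma step_fun_inside_steps: "step_fun (inside_steps s t) r = indicator {s<..t} r"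
  by (simp add: step_fun_def inside_steps_def)

definition W_mixed ::
  "real \<Rightarrow> real \<Rightarrow> real \<Rightarrow> (real \<Rightarrow> 'a \<Rightarrow> 'v::real_vector) \<Rightarrow> (real \<Rightarrow> 'b \<Rightarrow> 'v) \<Rightarrow>
     real \<Rightarrow> 'a \<times> 'b \<Rightarrow> 'v" where
  "W_mixed T s t W W' r \<eta> =
     step_integral (outside_steps T s t) (W0 W) r \<eta> + step_integral (inside_steps s t) (W1 W') r \<eta>"

text \<open>The normalized Haar functions on \<open>(0, T]\<close>: \<open>k = 0\<close> is the constant one, and
  \<open>k = 2\<^sup>j + m\<close> with \<open>m < 2\<^sup>j\<close> is the one supported by the \<open>m\<close>-th dyadic interval of
  level \<open>j\<close>.\<close>

definition haar_steps :: "real \<Rightarrow> nat \<Rightarrow> (real \<times> real \<times> real) list" where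
  "haar_steps T k =
     (if k = 0 then [(1 / sqrt T, 0, T)]
      else let j = floor_log k; m = real (k - 2 ^ j); c = sqrt (2 ^ j / T); l = T / 2 ^ j
           in [(c, m * l, (m + 1/2) * l), (- c, (m + 1/2) * l, (m + 1) * l)])"

definition haar_integrals :: "real \<Rightarrow> (real \<Rightarrow> 'o \<Rightarrow> real ^ 'd) \<Rightarrow> 'o \<Rightarrow> nat \<Rightarrow> real ^ 'd" where
  "haar_integrals T B \<eta> = (\<lambda>k. step_integral (haar_steps T k) B T \<eta>)"

definition F0 :: "real \<Rightarrow> 'a measure \<Rightarrow> 'b measure \<Rightarrow> (real \<Rightarrow> 'a \<Rightarrow> real ^ 'd) \<Rightarrow> ('a \<times> 'b) measure"
  where "F0 T M M' W = aug_sigma (Omega_bar M M') (W0 W ` {0..T})"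

definition F_mixed ::
  "real \<Rightarrow> real \<Rightarrow> real \<Rightarrow> 'a measure \<Rightarrow> 'b measure \<Rightarrow> (real \<Rightarrow> 'a \<Rightarrow> real ^ 'd) \<Rightarrow>
     (real \<Rightarrow> 'b \<Rightarrow> real ^ 'd) \<Rightarrow> ('a \<times> 'b) measure" where
  "F_mixed T s t M M' W W' = aug_sigma (Omega_bar M M') (W_mixed T s t W W' ` {0..T})"

definition G_bar ::
  "real \<Rightarrow> real \<Rightarrow> real \<Rightarrow> 'a measure \<Rightarrow> 'b measure \<Rightarrow> (real \<Rightarrow> 'a \<Rightarrow> real ^ 'd) \<Rightarrow> ('a \<times> 'b) measure"
  where "G_bar T s t M M' W =
     aug_sigma (Omega_bar M M') (W0 W ` {0..s} \<union> (\<lambda>r \<eta>. W0 W r \<eta> - W0 W t \<eta>) ` {t..T})"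

text \<open>The \<open>\<sigma>\<close>-algebra \<open>\<B>([0,T]) \<otimes> \<A>\<close>.\<close>

definition time_prod :: "real \<Rightarrow> 'o measure \<Rightarrow> (real \<times> 'o) measure" where
  "time_prod T A = restrict_space borel {0..T} \<Otimes>\<^sub>M A"

definition Omega_bar_T :: "real \<Rightarrow> 'a measure \<Rightarrow> 'b measure \<Rightarrow> (real \<times> 'a \<times> 'b) measure" where
  "Omega_bar_T T M M' =
     scale_measure (ennreal (1 / T)) (restrict_space lborel {0..T}) \<Otimes>\<^sub>M Omega_bar M M'"

text \<open>The set \<open>\<L>\<^sub>0(\<Omega>, \<Sigma>; C(\<X>))\<close>, as a set of functions, without identification.\<close>

definition L0_C :: "'o measure \<Rightarrow> ('o \<Rightarrow> 'x::topological_space \<Rightarrow> real) set" where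
  "L0_C \<Sigma> = {f. (\<forall>x. (\<lambda>\<eta>. f \<eta> x) \<in> borel_measurable \<Sigma>) \<and>
               (\<forall>\<eta>\<in>space \<Sigma>. continuous_on UNIV (f \<eta>))}"

text \<open>\<open>Y\<close> is a representative of the equivalence class \<open>X\<^bsup>(s,t]\<^esup>\<close>.\<close>

definition is_decoupled ::
  "real \<Rightarrow> real \<Rightarrow> real \<Rightarrow> 'a measure \<Rightarrow> 'b measure \<Rightarrow> (real \<Rightarrow> 'a \<Rightarrow> real ^ 'd) \<Rightarrow>
     (real \<Rightarrow> 'b \<Rightarrow> real ^ 'd) \<Rightarrow> (real \<times> 'a \<times> 'b \<Rightarrow> real) \<Rightarrow> (real \<times> 'a \<times> 'b \<Rightarrow> real) \<Rightarrow> bool" where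
  "is_decoupled T s t M M' W W' X Y \<longleftrightarrow>
     Y \<in> borel_measurable (time_prod T (F_mixed T s t M M' W W')) \<and>
     (\<exists>Xhat \<in> borel_measurable (time_prod T (\<Pi>\<^sub>M k\<in>(UNIV::nat set). (borel :: (real ^ 'd) measure))).
        (AE (r, \<eta>) in Omega_bar_T T M M'. X (r, \<eta>) = Xhat (r, haar_integrals T (W0 W) \<eta>)) \<and>
        (AE (r, \<eta>) in Omega_bar_T T M M'.
           Y (r, \<eta>) = Xhat (r, haar_integrals T (W_mixed T s t W W') \<eta>)))"

text \<open>\<open>g\<close> is a representative of \<open>f\<^bsup>(s,t]\<^esup>\<close> (unique up to indistinguishability).\<close>

definition is_decoupled_C ::
  "real \<Rightarrow> real \<Rightarrow> real \<Rightarrow> 'a measure \<Rightarrow> 'b measure \<Rightarrow> (real \<Rightarrow> 'a \<Rightarrow> real ^ 'd) \<Rightarrow>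
     (real \<Rightarrow> 'b \<Rightarrow> real ^ 'd) \<Rightarrow> (real \<times> 'a \<times> 'b \<Rightarrow> 'x::topological_space \<Rightarrow> real) \<Rightarrow>
     (real \<times> 'a \<times> 'b \<Rightarrow> 'x \<Rightarrow> real) \<Rightarrow> bool" where
  "is_decoupled_C T s t M M' W W' f g \<longleftrightarrow>
     g \<in> L0_C (time_prod T (F_mixed T s t M M' W W')) \<and>
     (\<forall>x. is_decoupled T s t M M' W W' (\<lambda>\<eta>. f \<eta> x) (\<lambda>\<eta>. g \<eta> x))"

text \<open>\<open>g\<close> is a version, continuous in \<open>x\<close>, of the conditional expectation of \<open>f\<close> given \<open>H\<close>
  (unique up to indistinguishability).\<close>

definition is_cond_exp_C ::
  "'o measure \<Rightarrow> 'o measure \<Rightarrow> ('o \<Rightarrow> 'x::topological_space \<Rightarrow> real) \<Rightarrow> ('o \<Rightarrow> 'x \<Rightarrow> real) \<Rightarrow> bool" where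
  "is_cond_exp_C N H f g \<longleftrightarrow>
     g \<in> L0_C H \<and> (\<forall>x. AE \<eta> in N. g \<eta> x = real_cond_exp N H (\<lambda>\<eta>. f \<eta> x) \<eta>)"

definition sup_dist_integral ::
  "real \<Rightarrow> real \<Rightarrow> (real \<times> 'o \<Rightarrow> 'x \<Rightarrow> real) \<Rightarrow> (real \<times> 'o \<Rightarrow> 'x \<Rightarrow> real) \<Rightarrow> 'o \<Rightarrow> ennreal" where
  "sup_dist_integral u1 u2 f g \<eta> =
     (\<integral>\<^sup>+ r\<in>{u1..u2}. (SUP x. ennreal \<bar>f (r, \<eta>) x - g (r, \<eta>) x\<bar>) \<partial>lborel)"

end

theory Submission
  imports Defs
begin

text \<open>Write \<open>N\<close> for the completed product space. Up to its initial value, the path of \<open>W\<^sup>0\<close> is the sum of an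
outer part \<open>O\<close>, built from the increments outside \<open>(s, t]\<close>, and an inner part \<open>I\<^sub>0\<close>, built from the
increments inside; replacing \<open>I\<^sub>0\<close> by the inner part \<open>I\<^sub>1\<close> of the second Brownian motion gives
\<open>W\<^bsup>(s,t]\<^esup>\<close>. Haar integrals only see increments, so up to null sets
\<open>f(r, x) = \<phi>\<^sub>x(r, O, I\<^sub>0)\<close> and \<open>f\<^bsup>(s,t]\<^esup>(r, x) = \<phi>\<^sub>x(r, O, I\<^sub>1)\<close> for one and the same function \<open>\<phi>\<^sub>x\<close>.
Three facts about the inner parts carry the proof: \<open>I\<^sub>0\<close> is independent of \<open>G\<close>
(\<open>outer_inner_path_independent\<close>), \<open>I\<^sub>1\<close> is independent of the larger \<open>\<sigma>\<close>-algebra generated by all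
of \<open>W\<^sup>0\<close>, because it lives on the other factor of the product, and both have the same law \<open>\<mu>\<close>
(\<open>distr_inner_path_eq\<close>). Hence (\<open>nn_cond_exp_independent\<close>) conditioning on \<open>G\<close> freezes whatever
is \<open>G\<close>-measurable and integrates the inner part against \<open>\<mu>\<close>.

For the upper bound (\<open>cond_exp_dec_le\<close>), the conditional expectation \<open>g\<close> of \<open>f\<close> is
\<open>G\<close>-measurable, so freezing gives the same value for the distance from \<open>g\<close> to \<open>f\<close> and for the
distance from \<open>g\<close> to \<open>f\<^bsup>(s,t]\<^esup>\<close>; the triangle inequality and
\<open>(a + b)\<^sup>p \<le> 2\<^bsup>p-1\<^esup> (a\<^sup>p + b\<^sup>p)\<close> then produce the constant \<open>2\<^bsup>p-1\<^esup> \<cdot> 2\<close>.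

For the lower bound (\<open>cond_exp_cond_le\<close>), freezing shows \<open>g(r, x) = \<integral> \<phi>\<^sub>x(r, O, y) \<mu>(dy)\<close>. Pulling
this integral out of the absolute value, the supremum and the time integral bounds the distance from
\<open>f\<close> to \<open>g\<close> by the \<open>\<mu>\<close>-mean of the distances from \<open>f\<close> to \<open>\<phi>(\<cdot>, O, y)\<close>. By Jensen's inequality its
\<open>p\<close>-th power is at most the \<open>\<mu>\<close>-mean of the \<open>p\<close>-th powers, and freezing once more, now with
respect to the \<open>\<sigma>\<close>-algebra of \<open>W\<^sup>0\<close>, identifies that mean with the conditional expectation of the
\<open>p\<close>-th power of the distance from \<open>f\<close> to \<open>f\<^bsup>(s,t]\<^esup>\<close>. Conditioning on \<open>G\<close> and the tower property
finish the argument.\<close>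

section \<open>Powers of extended nonnegative reals\<close>

lemma enn_powr_ennreal: "0 \<le> x \<Longrightarrow> enn_powr (ennreal x) p = ennreal (x powr p)"
  by (simp add: enn_powr_def)

lemma enn_powr_mono: "0 \<le> p \<Longrightarrow> a \<le> b \<Longrightarrow> enn_powr a p \<le> enn_powr b p"
  by (auto simp: enn_powr_def top_unique less_top[symmetric] intro!: ennreal_leI powr_mono2 enn2real_mono)

lemma borel_measurable_enn_powr [measurable]:
  "g \<in> borel_measurable N \<Longrightarrow> (\<lambda>\<eta>. enn_powr (g \<eta>) p) \<in> borel_measurable N"
  unfolding enn_powr_def
  by (intro measurable_If powr_real_measurable borel_measurable_enn2real
      borel_measurable_const measurable_const pred_eq_const1[where N = borel]) auto

text \<open>The convex function \<open>z \<mapsto> z\<^sup>p\<close> lies above its tangent at \<open>m\<close>. This is Young's inequality for the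
weights \<open>1/p\<close> and \<open>1 - 1/p\<close>, and both convexity inequalities below follow from it.\<close>

lemma powr_tangent:
  fixes z m p :: real
  assumes "1 \<le> p" "0 \<le> z" "0 \<le> m"
  shows "p * m powr (p - 1) * z \<le> z powr p + (p - 1) * m powr p"
proof (cases "z = 0 \<or> m = 0")
  case False
  with assms have "z > 0" "m > 0" by linarith+
  have "(z powr p) powr (1 / p) * (m powr p) powr (1 - 1 / p) \<le> 1 / p * z powr p + (1 - 1 / p) * m powr p"
    using assms \<open>z > 0\<close> \<open>m > 0\<close> by (intro Youngs_inequality_0) auto
  moreover have "(z powr p) powr (1 / p) = z" "(m powr p) powr (1 - 1 / p) = m powr (p - 1)"
    using assms by (auto simp: powr_powr algebra_simps)
  ultimately have "p * (z * m powr (p - 1)) \<le> p * (1 / p * z powr p + (1 - 1 / p) * m powr p)"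
    using assms by (intro mult_left_mono) auto
  also have "\<dots> = z powr p + (p - 1) * m powr p"
    using assms by (simp add: field_simps)
  finally show ?thesis by (simp add: mult_ac)
qed (use assms in auto)

lemma enn_powr_tangent:
  assumes "1 \<le> p" "0 \<le> m"
  shows "ennreal (p * m powr (p - 1)) * z \<le> enn_powr z p + ennreal ((p - 1) * m powr p)"
proof (cases z)
  case (real x)
  then show ?thesis
    using powr_tangent[OF assms(1) _ assms(2), of x] assms
    by (simp add: enn_powr_ennreal flip: ennreal_mult ennreal_plus)
qed (simp add: enn_powr_def)

text \<open>Adding the tangent inequalities at the midpoint \<open>m = (a + b) / 2\<close> for the two arguments gives
\<open>2 m\<^sup>p \<le> a\<^sup>p + b\<^sup>p\<close>.\<close>

lemma enn_powr_add_le: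
  assumes "1 \<le> p"
  shows "enn_powr (a + b) p \<le> ennreal (2 powr (p - 1)) * (enn_powr a p + enn_powr b p)"
proof (cases a; cases b)
  fix x y assume xy: "a = ennreal x" "0 \<le> x" "b = ennreal y" "0 \<le> y"
  define m where "m = (x + y) / 2"
  have m: "0 \<le> m" "x + y = 2 * m" using xy by (auto simp: m_def)
  have *: "m powr (p - 1) * m = m powr p"
    using m(1) by (cases "m = 0") (auto simp: powr_diff)
  have "2 * (p * m powr p) = p * m powr (p - 1) * x + p * m powr (p - 1) * y"
    unfolding *[symmetric] distrib_left[symmetric] m(2) by (simp add: mult_ac)
  also have "\<dots> \<le> x powr p + y powr p + 2 * ((p - 1) * m powr p)"
    using powr_tangent[OF assms xy(2) m(1)] powr_tangent[OF assms xy(4) m(1)] by simp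
  finally have "2 * m powr p \<le> x powr p + y powr p" by (simp add: algebra_simps)
  then have "2 powr (p - 1) * (2 * m powr p) \<le> 2 powr (p - 1) * (x powr p + y powr p)"
    by (rule mult_left_mono) simp
  moreover have "2 powr (p - 1) * (2 * m powr p) = (x + y) powr p"
    unfolding m(2) using m(1) by (simp add: powr_mult powr_diff)
  ultimately have le: "(x + y) powr p \<le> 2 powr (p - 1) * (x powr p + y powr p)" by linarith
  have "enn_powr (a + b) p = ennreal ((x + y) powr p)"
    using xy by (simp add: enn_powr_ennreal del: ennreal_plus add: ennreal_plus[symmetric])
  also have "\<dots> \<le> ennreal (2 powr (p - 1) * (x powr p + y powr p))" using le by (rule ennreal_leI)
  also have "\<dots> = ennreal (2 powr (p - 1)) * (enn_powr a p + enn_powr b p)"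
    using xy by (simp add: enn_powr_ennreal ennreal_mult)
  finally show ?thesis .
qed (auto simp: enn_powr_def ennreal_mult_top)

text \<open>Jensen's inequality, with infinite values allowed: integrate the tangent inequality at the mean.
If the mean is infinite, the tangent at \<open>1\<close> already shows that the right-hand side is infinite.\<close>

lemma (in prob_space) enn_powr_nn_integral_le:
  assumes [measurable]: "g \<in> borel_measurable M" and "1 \<le> p"
  shows "enn_powr (\<integral>\<^sup>+ \<omega>. g \<omega> \<partial>M) p \<le> (\<integral>\<^sup>+ \<omega>. enn_powr (g \<omega>) p \<partial>M)"
proof -
  have tangent: "ennreal (p * m powr (p - 1)) * (\<integral>\<^sup>+ \<omega>. g \<omega> \<partial>M)
      \<le> (\<integral>\<^sup>+ \<omega>. enn_powr (g \<omega>) p \<partial>M) + ennreal ((p - 1) * m powr p)" if "0 \<le> m" for m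
  proof -
    have "ennreal (p * m powr (p - 1)) * (\<integral>\<^sup>+ \<omega>. g \<omega> \<partial>M) = (\<integral>\<^sup>+ \<omega>. ennreal (p * m powr (p - 1)) * g \<omega> \<partial>M)"
      by (simp add: nn_integral_cmult)
    also have "\<dots> \<le> (\<integral>\<^sup>+ \<omega>. enn_powr (g \<omega>) p + ennreal ((p - 1) * m powr p) \<partial>M)"
      by (intro nn_integral_mono enn_powr_tangent assms that)
    also have "\<dots> = (\<integral>\<^sup>+ \<omega>. enn_powr (g \<omega>) p \<partial>M) + ennreal ((p - 1) * m powr p)"
      by (simp add: nn_integral_add emeasure_space_1)
    finally show ?thesis .
  qed
  show ?thesis
  proof (cases "\<integral>\<^sup>+ \<omega>. g \<omega> \<partial>M")
    case (real m)
    have *: "m powr (p - 1) * m = m powr p"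
      using real by (cases "m = 0") (auto simp: powr_diff)
    have "ennreal (m powr p) + ennreal ((p - 1) * m powr p) = ennreal (m powr p + (p - 1) * m powr p)"
      using assms by (intro ennreal_plus[symmetric]) auto
    also have "m powr p + (p - 1) * m powr p = p * m powr (p - 1) * m"
      using * by (simp add: algebra_simps)
    also have "ennreal \<dots> = ennreal (p * m powr (p - 1)) * ennreal m"
      using assms real by (intro ennreal_mult) auto
    also have "\<dots> \<le> (\<integral>\<^sup>+ \<omega>. enn_powr (g \<omega>) p \<partial>M) + ennreal ((p - 1) * m powr p)"
      using tangent[of m] real by simp
    finally show ?thesis
      using real by (simp add: enn_powr_ennreal)
  next
    case top
    with tangent[of 1] show ?thesis
      using assms by (simp add: ennreal_mult_top enn_powr_def top_unique)
  qed
qed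

section \<open>Suprema over a countable dense set\<close>

text \<open>Local \<open>\<sigma>\<close>-compactness enters the proof through separability: every compact \<open>K\<^sub>n\<close> is totally bounded, and
the centres of finite \<open>1/(m+1)\<close>-nets of all \<open>K\<^sub>n\<close> are dense. For fields continuous in \<open>x\<close> this
makes the suprema over the space measurable and turns families of almost sure identities, one for each \<open>x\<close>,
into a single one.\<close>

lemma locally_sigma_compact_dense:
  assumes "locally_sigma_compact TYPE('x::complete_space)"
  obtains D :: "'x::complete_space set" where "countable D" "closure D = UNIV"
proof -
  obtain K :: "nat \<Rightarrow> 'x set" where K: "\<And>n. compact (K n)" "(\<Union>n. interior (K n)) = UNIV"
    using assms unfolding locally_sigma_compact_def by blast
  have "\<exists>k. finite k \<and> K n \<subseteq> (\<Union>x\<in>k. ball x (1 / Suc m))" for n m :: nat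
    using K(1)[of n] unfolding compact_eq_totally_bounded by (meson of_nat_0_less_iff zero_less_Suc zero_less_divide_1_iff)
  then obtain k where k: "\<And>n m. finite (k n m)" "\<And>n m. K n \<subseteq> (\<Union>x\<in>k n m. ball x (1 / Suc m))"
    by metis
  have "countable (\<Union>n m. k n m)"
    by (rule countable_UN[OF countableI_type], rule countable_UN[OF countableI_type], rule countable_finite[OF k(1)])
  moreover have "x \<in> closure (\<Union>n m. k n m)" for x
  proof -
    obtain n where n: "x \<in> K n" using K(2) interior_subset by blast
    show ?thesis
      unfolding closure_approachable
    proof (intro allI impI)
      fix e :: real assume "0 < e"
      then obtain m where m: "1 / Suc m < e"
        using nat_approx_posE by metis
      from n k(2)[of n m] obtain y where "y \<in> k n m" "dist y x < 1 / Suc m" by auto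
      with m show "\<exists>y\<in>\<Union>n m. k n m. dist y x < e" by force
    qed
  qed
  ultimately show thesis using that by blast
qed

lemma SUP_dense_eq:
  fixes h :: "'x::topological_space \<Rightarrow> real"
  assumes "continuous_on UNIV h" "closure D = UNIV"
  shows "(SUP x. ennreal \<bar>h x\<bar>) = (SUP x\<in>D. ennreal \<bar>h x\<bar>)"
proof (rule antisym)
  let ?c = "SUP x\<in>D. ennreal \<bar>h x\<bar>"
  have "closed {x. ennreal \<bar>h x\<bar> \<le> ?c}"
    using assms(1) by (intro closed_Collect_le continuous_on_ennreal continuous_intros)
  moreover have "D \<subseteq> {x. ennreal \<bar>h x\<bar> \<le> ?c}"
    by (auto intro: SUP_upper)
  ultimately have "closure D \<subseteq> {x. ennreal \<bar>h x\<bar> \<le> ?c}"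
    by (rule closure_minimal[rotated])
  then show "(SUP x. ennreal \<bar>h x\<bar>) \<le> ?c"
    using assms(2) by (auto intro: SUP_least)
qed (rule SUP_subset_mono, auto)

section \<open>Conditioning on an independent \<sigma>-algebra\<close>

definition independent_with_law :: "'o measure \<Rightarrow> 'o measure \<Rightarrow> ('o \<Rightarrow> 'q) \<Rightarrow> 'q measure \<Rightarrow> bool" where
  "independent_with_law N A I \<mu> \<longleftrightarrow> I \<in> N \<rightarrow>\<^sub>M \<mu> \<and>
     (\<forall>S\<in>sets A. \<forall>B\<in>sets \<mu>. emeasure N (S \<inter> I -` B) = emeasure N S * emeasure \<mu> B)"

lemma measurable_subalgebra_pair:
  assumes "subalgebra N A" "h \<in> A \<Otimes>\<^sub>M \<mu> \<rightarrow>\<^sub>M K"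
  shows "h \<in> N \<Otimes>\<^sub>M \<mu> \<rightarrow>\<^sub>M K"
proof -
  have "(\<lambda>z. (fst z, snd z)) \<in> N \<Otimes>\<^sub>M \<mu> \<rightarrow>\<^sub>M A \<Otimes>\<^sub>M \<mu>"
    by (intro measurable_Pair measurable_snd measurable_compose[OF measurable_fst measurable_from_subalg[OF assms(1)]]) simp
  from measurable_compose[OF this assms(2)] show ?thesis by simp
qed

text \<open>Independence says that \<open>\<eta> \<mapsto> (\<eta>, I \<eta>)\<close> maps \<open>N\<close> to the product of \<open>N\<close> restricted to \<open>A\<close> with \<open>\<mu>\<close>;
the formula is Fubini's theorem for this product.\<close>

lemma nn_integral_independent:
  assumes "prob_space N" "prob_space \<mu>" and sub: "subalgebra N A"
    and ind: "independent_with_law N A I \<mu>"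
    and h: "h \<in> borel_measurable (A \<Otimes>\<^sub>M \<mu>)"
  shows "(\<integral>\<^sup>+ \<eta>. h (\<eta>, I \<eta>) \<partial>N) = (\<integral>\<^sup>+ \<eta>. \<integral>\<^sup>+ y. h (\<eta>, y) \<partial>\<mu> \<partial>N)"
proof -
  interpret N: prob_space N by fact
  interpret \<mu>: prob_space \<mu> by fact
  interpret A: prob_space "restr_to_subalg N A"
    by (rule prob_space_restr_to_subalg[OF sub]) fact
  have [measurable]: "I \<in> N \<rightarrow>\<^sub>M \<mu>" "(\<lambda>\<eta>. \<eta>) \<in> N \<rightarrow>\<^sub>M A"
    using ind measurable_from_subalg[OF sub, of "\<lambda>\<eta>. \<eta>" A] by (auto simp: independent_with_law_def)
  note [measurable] = h
  have sets: "sets (restr_to_subalg N A \<Otimes>\<^sub>M \<mu>) = sets (A \<Otimes>\<^sub>M \<mu>)"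
    by (intro sets_pair_measure_cong sets_restr_to_subalg[OF sub] refl)
  have "restr_to_subalg N A \<Otimes>\<^sub>M \<mu> = distr N (A \<Otimes>\<^sub>M \<mu>) (\<lambda>\<eta>. (\<eta>, I \<eta>))"
  proof (rule pair_measure_eqI)
    fix S B assume S: "S \<in> sets (restr_to_subalg N A)" and B: "B \<in> sets \<mu>"
    then have [measurable]: "S \<in> sets A" "B \<in> sets \<mu>" by (auto simp: sets_restr_to_subalg[OF sub])
    have "S \<subseteq> space N" using sets.sets_into_space[OF \<open>S \<in> sets A\<close>] sub by (simp add: subalgebra_def)
    then have "(\<lambda>\<eta>. (\<eta>, I \<eta>)) -` (S \<times> B) \<inter> space N = S \<inter> I -` B" by auto
    then have "emeasure (distr N (A \<Otimes>\<^sub>M \<mu>) (\<lambda>\<eta>. (\<eta>, I \<eta>))) (S \<times> B) = emeasure N (S \<inter> I -` B)"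
      by (simp add: emeasure_distr)
    also have "\<dots> = emeasure N S * emeasure \<mu> B"
      using ind \<open>S \<in> sets A\<close> \<open>B \<in> sets \<mu>\<close> by (simp add: independent_with_law_def)
    finally show "emeasure (restr_to_subalg N A) S * emeasure \<mu> B
        = emeasure (distr N (A \<Otimes>\<^sub>M \<mu>) (\<lambda>\<eta>. (\<eta>, I \<eta>))) (S \<times> B)"
      using emeasure_restr_to_subalg[OF sub \<open>S \<in> sets A\<close>] by simp
  qed (simp_all add: sets A.sigma_finite_measure_axioms \<mu>.sigma_finite_measure_axioms)
  then have "(\<integral>\<^sup>+ \<eta>. h (\<eta>, I \<eta>) \<partial>N) = (\<integral>\<^sup>+ z. h z \<partial>(restr_to_subalg N A \<Otimes>\<^sub>M \<mu>))"
    by (simp add: nn_integral_distr)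
  also have "\<dots> = (\<integral>\<^sup>+ \<eta>. \<integral>\<^sup>+ y. h (\<eta>, y) \<partial>\<mu> \<partial>restr_to_subalg N A)"
    using h by (intro \<mu>.nn_integral_fst[symmetric]) (simp add: measurable_cong_sets[OF sets refl])
  also have "\<dots> = (\<integral>\<^sup>+ \<eta>. \<integral>\<^sup>+ y. h (\<eta>, y) \<partial>\<mu> \<partial>N)"
    by (intro nn_integral_subalgebra2[OF sub]) measurable
  finally show ?thesis .
qed

text \<open>The freezing lemma: the \<open>A\<close>-measurable argument is kept, the independent one is averaged out.\<close>

lemma nn_cond_exp_independent:
  assumes "prob_space N" "prob_space \<mu>" and sub: "subalgebra N A"
    and ind: "independent_with_law N A I \<mu>"
    and h [measurable]: "h \<in> borel_measurable (A \<Otimes>\<^sub>M \<mu>)"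
  shows "AE \<eta> in N. nn_cond_exp N A (\<lambda>\<eta>. h (\<eta>, I \<eta>)) \<eta> = (\<integral>\<^sup>+ y. h (\<eta>, y) \<partial>\<mu>)"
proof -
  interpret N: prob_space N by fact
  interpret \<mu>: prob_space \<mu> by fact
  interpret NA: finite_measure_subalgebra N A by unfold_locales (rule sub)
  have [measurable]: "I \<in> N \<rightarrow>\<^sub>M \<mu>" "(\<lambda>\<eta>. \<eta>) \<in> N \<rightarrow>\<^sub>M A"
    using ind measurable_from_subalg[OF sub, of "\<lambda>\<eta>. \<eta>" A] by (auto simp: independent_with_law_def)
  have "AE \<eta> in N. (\<integral>\<^sup>+ y. h (\<eta>, y) \<partial>\<mu>) = nn_cond_exp N A (\<lambda>\<eta>. h (\<eta>, I \<eta>)) \<eta>"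
  proof (rule NA.nn_cond_exp_charact)
    fix S assume [measurable]: "S \<in> sets A"
    have "(\<integral>\<^sup>+ \<eta>\<in>S. h (\<eta>, I \<eta>) \<partial>N) = (\<integral>\<^sup>+ \<eta>. \<integral>\<^sup>+ y. h (\<eta>, y) * indicator S \<eta> \<partial>\<mu> \<partial>N)"
      using nn_integral_independent[OF assms(1-4), of "\<lambda>z. h z * indicator S (fst z)"] by simp
    also have "\<dots> = (\<integral>\<^sup>+ \<eta>\<in>S. (\<integral>\<^sup>+ y. h (\<eta>, y) \<partial>\<mu>) \<partial>N)"
    proof (rule nn_integral_cong)
      fix \<eta> assume "\<eta> \<in> space N"
      then have [measurable]: "(\<lambda>y. h (\<eta>, y)) \<in> borel_measurable \<mu>"
        using sub by (intro measurable_compose[OF _ h] measurable_Pair1') (simp add: subalgebra_def)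
      show "(\<integral>\<^sup>+ y. h (\<eta>, y) * indicator S \<eta> \<partial>\<mu>) = (\<integral>\<^sup>+ y. h (\<eta>, y) \<partial>\<mu>) * indicator S \<eta>"
        by (simp add: nn_integral_multc)
    qed
    finally show "(\<integral>\<^sup>+ \<eta>\<in>S. h (\<eta>, I \<eta>) \<partial>N) = (\<integral>\<^sup>+ \<eta>\<in>S. (\<integral>\<^sup>+ y. h (\<eta>, y) \<partial>\<mu>) \<partial>N)" .
  qed measurable
  then show ?thesis by eventually_elim simp
qed

text \<open>Independence survives the passage to the space with an added time variable, because it can be
checked on the sections at fixed time. So the freezing lemma also applies to conditioning on
\<open>\<B>([0,T]) \<otimes> G\<close>.\<close>

lemma independent_with_law_times:
  assumes "prob_space R" "prob_space N" and sub: "subalgebra N A"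
    and ind: "independent_with_law N A I \<mu>"
  shows "independent_with_law (R \<Otimes>\<^sub>M N) (R \<Otimes>\<^sub>M A) (I \<circ> snd) \<mu>"
proof -
  interpret R: prob_space R by fact
  interpret N: prob_space N by fact
  have [measurable]: "I \<in> N \<rightarrow>\<^sub>M \<mu>" "(\<lambda>\<eta>. \<eta>) \<in> N \<rightarrow>\<^sub>M A"
    using ind measurable_from_subalg[OF sub, of "\<lambda>\<eta>. \<eta>" A] by (auto simp: independent_with_law_def)
  have subR: "sets (R \<Otimes>\<^sub>M A) \<subseteq> sets (R \<Otimes>\<^sub>M N)" and sp: "space A = space N"
    using sub unfolding sets_pair_measure by (auto simp: subalgebra_def intro!: sigma_sets_mono')
  show ?thesis
    unfolding independent_with_law_def
  proof (intro conjI ballI)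
    show "I \<circ> snd \<in> R \<Otimes>\<^sub>M N \<rightarrow>\<^sub>M \<mu>" by measurable
  next
    fix S B assume S: "S \<in> sets (R \<Otimes>\<^sub>M A)" and B [measurable]: "B \<in> sets \<mu>"
    have S' [measurable]: "S \<in> sets (R \<Otimes>\<^sub>M N)" using S subR by auto
    have "{z \<in> space (R \<Otimes>\<^sub>M N). z \<in> S \<and> I (snd z) \<in> B} \<in> sets (R \<Otimes>\<^sub>M N)" by measurable
    also have "{z \<in> space (R \<Otimes>\<^sub>M N). z \<in> S \<and> I (snd z) \<in> B} = S \<inter> (I \<circ> snd) -` B"
      using sets.sets_into_space[OF S'] by auto
    finally have m: "S \<inter> (I \<circ> snd) -` B \<in> sets (R \<Otimes>\<^sub>M N)" .
    have "emeasure (R \<Otimes>\<^sub>M N) (S \<inter> (I \<circ> snd) -` B)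
        = (\<integral>\<^sup>+ r. emeasure N (Pair r -` (S \<inter> (I \<circ> snd) -` B)) \<partial>R)"
      by (rule N.emeasure_pair_measure_alt[OF m])
    also have "\<dots> = (\<integral>\<^sup>+ r. emeasure N (Pair r -` S) * emeasure \<mu> B \<partial>R)"
    proof (rule nn_integral_cong)
      fix r assume "r \<in> space R"
      have "Pair r -` (S \<inter> (I \<circ> snd) -` B) = Pair r -` S \<inter> I -` B" by auto
      moreover have "Pair r -` S \<in> sets A" using S by (rule sets_Pair1)
      ultimately show "emeasure N (Pair r -` (S \<inter> (I \<circ> snd) -` B)) = emeasure N (Pair r -` S) * emeasure \<mu> B"
        using ind B by (simp add: independent_with_law_def)
    qed
    also have "\<dots> = emeasure (R \<Otimes>\<^sub>M N) S * emeasure \<mu> B"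
      by (simp add: nn_integral_multc N.measurable_emeasure_Pair N.emeasure_pair_measure_alt)
    finally show "emeasure (R \<Otimes>\<^sub>M N) (S \<inter> (I \<circ> snd) -` B) = emeasure (R \<Otimes>\<^sub>M N) S * emeasure \<mu> B" .
  qed
qed

section \<open>Both inequalities for a decoupled field\<close>

lemma subalgebra_times: "subalgebra A B \<Longrightarrow> subalgebra (R \<Otimes>\<^sub>M A) (R \<Otimes>\<^sub>M B)"
  unfolding subalgebra_def sets_pair_measure space_pair_measure by (auto intro!: sigma_sets_mono')

lemma L0_C_mono: "subalgebra A B \<Longrightarrow> g \<in> L0_C B \<Longrightarrow> g \<in> L0_C A"
  unfolding L0_C_def
proof (intro CollectI conjI)
  assume "subalgebra A B"
    "g \<in> {f. (\<forall>x. (\<lambda>\<eta>. f \<eta> x) \<in> borel_measurable B) \<and> (\<forall>\<eta>\<in>space B. continuous_on UNIV (f \<eta>))}"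
  then show "\<forall>x. (\<lambda>\<eta>. g \<eta> x) \<in> borel_measurable A" "\<forall>\<eta>\<in>space A. continuous_on UNIV (g \<eta>)"
    by (blast intro: measurable_from_subalg[OF \<open>subalgebra A B\<close>], simp add: subalgebra_def)
qed

text \<open>The situation of the theorem without Brownian motion. \<open>R\<close> is the normalized time interval, \<open>w\<close> a
weight by which the integral over \<open>(u\<^sub>1, u\<^sub>2)\<close> is expressed as an integral over \<open>R\<close>, \<open>F\<close> plays the role
of the \<open>\<sigma>\<close>-algebra of \<open>W\<^sup>0\<close>, and \<open>I0\<close>, \<open>I1\<close> are the inner parts. The outer part is hidden in the dependence of \<open>\<phi> x\<close> on
its \<open>G\<close>-measurable argument.\<close>

locale decoupled_field =
  N: prob_space N + R: prob_space R + \<mu>: prob_space \<mu>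
  for N :: "'o measure" and R :: "'r measure" and \<mu> :: "'q measure" +
  fixes G F :: "'o measure" and I0 I1 :: "'o \<Rightarrow> 'q" and D :: "'x::topological_space set"
    and \<phi> :: "'x \<Rightarrow> ('r \<times> 'o) \<times> 'q \<Rightarrow> real" and f f_dec f_cond :: "'r \<times> 'o \<Rightarrow> 'x \<Rightarrow> real"
    and w :: "'r \<Rightarrow> ennreal"
  assumes sub_F: "subalgebra N F" and sub_GF: "subalgebra F G"
    and indep0: "independent_with_law N G I0 \<mu>"
    and indep1: "independent_with_law N F I1 \<mu>"
    and D: "countable D" "closure D = UNIV"
    and w [measurable]: "w \<in> borel_measurable R"
    and \<phi>: "\<And>x. \<phi> x \<in> borel_measurable ((R \<Otimes>\<^sub>M G) \<Otimes>\<^sub>M \<mu>)"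
    and f: "f \<in> L0_C (R \<Otimes>\<^sub>M F)" and f_dec: "f_dec \<in> L0_C (R \<Otimes>\<^sub>M N)"
    and f_cond: "f_cond \<in> L0_C (R \<Otimes>\<^sub>M G)"
    and f_eq: "\<And>x. AE z in R \<Otimes>\<^sub>M N. f z x = \<phi> x (z, I0 (snd z))"
    and f_dec_eq: "\<And>x. AE z in R \<Otimes>\<^sub>M N. f_dec z x = \<phi> x (z, I1 (snd z))"
    and f_int: "\<And>x. integrable (R \<Otimes>\<^sub>M N) (\<lambda>z. f z x)"
    and f_cond_eq: "\<And>x. AE z in R \<Otimes>\<^sub>M N. f_cond z x = real_cond_exp (R \<Otimes>\<^sub>M N) (R \<Otimes>\<^sub>M G) (\<lambda>z. f z x) z"
begin

sublocale RN: prob_space "R \<Otimes>\<^sub>M N"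
  by (rule prob_space_pair) unfold_locales

sublocale RN: pair_sigma_finite R N ..

sublocale NR: pair_sigma_finite N R ..

lemma sub_G: "subalgebra N G"
  using sub_F sub_GF by (auto simp: subalgebra_def)

lemma measurable_I [measurable]: "I0 \<in> N \<rightarrow>\<^sub>M \<mu>" "I1 \<in> N \<rightarrow>\<^sub>M \<mu>"
  using indep0 indep1 by (auto simp: independent_with_law_def)

lemma \<phi>_measurable [measurable]:
  "\<phi> x \<in> borel_measurable ((R \<Otimes>\<^sub>M F) \<Otimes>\<^sub>M \<mu>)" "\<phi> x \<in> borel_measurable ((R \<Otimes>\<^sub>M N) \<Otimes>\<^sub>M \<mu>)"
  by (rule measurable_subalgebra_pair[OF subalgebra_times \<phi>], fact sub_GF sub_G)+

text \<open>Swapping the factors preserves the product measure, so its null sets can be sectioned in either order.\<close>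

lemma AE_pair_commute: "AE z in R \<Otimes>\<^sub>M N. P z \<Longrightarrow> AE \<eta> in N. AE r in R. P (r, \<eta>)"
proof -
  assume "AE z in R \<Otimes>\<^sub>M N. P z"
  then have "AE z in distr (N \<Otimes>\<^sub>M R) (R \<Otimes>\<^sub>M N) (\<lambda>(\<eta>, r). (r, \<eta>)). P z"
    by (subst RN.distr_pair_swap[symmetric])
  then have "AE z in N \<Otimes>\<^sub>M R. P (case z of (\<eta>, r) \<Rightarrow> (r, \<eta>))"
    by (rule AE_distrD[rotated]) (rule measurable_pair_swap')
  from NR.AE_pair[OF this] show ?thesis by simp
qed

definition sup_dist :: "('r \<times> 'o \<Rightarrow> 'x \<Rightarrow> real) \<Rightarrow> ('r \<times> 'o \<Rightarrow> 'x \<Rightarrow> real) \<Rightarrow> 'o \<Rightarrow> ennreal" where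
  "sup_dist g h \<eta> = (\<integral>\<^sup>+ r. w r * (SUP x. ennreal \<bar>g (r, \<eta>) x - h (r, \<eta>) x\<bar>) \<partial>R)"

text \<open>The distance between \<open>g\<close> and the field obtained by fixing the inner part at \<open>y\<close>. The supremum is
restricted to \<open>D\<close> because \<open>\<phi> x ((r, \<eta>), y)\<close> need not be continuous in \<open>x\<close>.\<close>

definition frozen_dist :: "('r \<times> 'o \<Rightarrow> 'x \<Rightarrow> real) \<Rightarrow> 'o \<times> 'q \<Rightarrow> ennreal" where
  "frozen_dist g = (\<lambda>(\<eta>, y). \<integral>\<^sup>+ r. w r * (SUP x\<in>D. ennreal \<bar>g (r, \<eta>) x - \<phi> x ((r, \<eta>), y)\<bar>) \<partial>R)"

lemma L0_C_SUP_dense: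
  fixes g h :: "'r \<times> 'o \<Rightarrow> 'x \<Rightarrow> real"
  assumes "g \<in> L0_C (R \<Otimes>\<^sub>M N)" "h \<in> L0_C (R \<Otimes>\<^sub>M N)" "z \<in> space (R \<Otimes>\<^sub>M N)"
  shows "(SUP x. ennreal \<bar>g z x - h z x\<bar>) = (SUP x\<in>D. ennreal \<bar>g z x - h z x\<bar>)"
  using assms D(2) by (intro SUP_dense_eq continuous_on_diff) (auto simp: L0_C_def)

lemma SUP_measurable:
  fixes g h :: "'r \<times> 'o \<Rightarrow> 'x \<Rightarrow> real"
  assumes "g \<in> L0_C (R \<Otimes>\<^sub>M N)" "h \<in> L0_C (R \<Otimes>\<^sub>M N)"
  shows "(\<lambda>z. SUP x. ennreal \<bar>g z x - h z x\<bar>) \<in> borel_measurable (R \<Otimes>\<^sub>M N)"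
proof -
  have [measurable]: "\<And>x. (\<lambda>z. g z x) \<in> borel_measurable (R \<Otimes>\<^sub>M N)"
    "\<And>x. (\<lambda>z. h z x) \<in> borel_measurable (R \<Otimes>\<^sub>M N)"
    using assms by (auto simp: L0_C_def)
  have "(\<lambda>z. SUP x\<in>D. ennreal \<bar>g z x - h z x\<bar>) \<in> borel_measurable (R \<Otimes>\<^sub>M N)"
    by (intro borel_measurable_SUP D) measurable
  then show ?thesis
    by (rule measurable_cong[THEN iffD1, rotated]) (simp add: L0_C_SUP_dense assms)
qed

lemma sup_dist_measurable:
  fixes g h :: "'r \<times> 'o \<Rightarrow> 'x \<Rightarrow> real"
  assumes "g \<in> L0_C (R \<Otimes>\<^sub>M N)" "h \<in> L0_C (R \<Otimes>\<^sub>M N)"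
  shows "sup_dist g h \<in> borel_measurable N"
proof -
  have "(\<lambda>(\<eta>, r). w r * (SUP x. ennreal \<bar>g (r, \<eta>) x - h (r, \<eta>) x\<bar>)) \<in> borel_measurable (N \<Otimes>\<^sub>M R)"
    using measurable_compose[OF measurable_pair_swap' SUP_measurable[OF assms]]
    by (auto simp: split_beta' intro!: borel_measurable_times_ennreal)
  then show ?thesis
    unfolding sup_dist_def by (rule R.borel_measurable_nn_integral)
qed

lemma frozen_dist_measurable:
  fixes g :: "'r \<times> 'o \<Rightarrow> 'x \<Rightarrow> real"
  assumes "\<And>x. (\<lambda>z. g z x) \<in> borel_measurable (R \<Otimes>\<^sub>M A)"
    and "\<And>x. \<phi> x \<in> borel_measurable ((R \<Otimes>\<^sub>M A) \<Otimes>\<^sub>M \<mu>)"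
  shows "frozen_dist g \<in> borel_measurable (A \<Otimes>\<^sub>M \<mu>)"
proof -
  have "(\<lambda>p. ennreal \<bar>g (snd p, fst (fst p)) x - \<phi> x ((snd p, fst (fst p)), snd (fst p))\<bar>)
      \<in> borel_measurable ((A \<Otimes>\<^sub>M \<mu>) \<Otimes>\<^sub>M R)" for x
    by (intro measurable_compose[OF _ measurable_ennreal] borel_measurable_abs borel_measurable_diff
        measurable_compose[OF _ assms(1)] measurable_compose[OF _ assms(2)] measurable_Pair) measurable
  then have "(\<lambda>p. w (snd p) * (SUP x\<in>D. ennreal \<bar>g (snd p, fst (fst p)) x - \<phi> x ((snd p, fst (fst p)), snd (fst p))\<bar>))
      \<in> borel_measurable ((A \<Otimes>\<^sub>M \<mu>) \<Otimes>\<^sub>M R)"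
    by (intro borel_measurable_times_ennreal borel_measurable_SUP D) auto
  then show ?thesis
    unfolding frozen_dist_def split_beta'
    by (intro R.borel_measurable_nn_integral) (simp add: split_beta')
qed

lemma sup_dist_eq_frozen_dist:
  fixes g h :: "'r \<times> 'o \<Rightarrow> 'x \<Rightarrow> real"
  assumes g: "g \<in> L0_C (R \<Otimes>\<^sub>M N)" and h: "h \<in> L0_C (R \<Otimes>\<^sub>M N)"
    and h_eq: "\<And>x. AE z in R \<Otimes>\<^sub>M N. h z x = \<phi> x (z, I (snd z))"
  shows "AE \<eta> in N. sup_dist g h \<eta> = frozen_dist g (\<eta>, I \<eta>)"
proof -
  have "AE z in R \<Otimes>\<^sub>M N. \<forall>x\<in>D. h z x = \<phi> x (z, I (snd z))"
    using h_eq D(1) by (subst AE_ball_countable) auto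
  then have "AE z in R \<Otimes>\<^sub>M N. (SUP x. ennreal \<bar>g z x - h z x\<bar>)
      = (SUP x\<in>D. ennreal \<bar>g z x - \<phi> x (z, I (snd z))\<bar>)"
    using AE_space by eventually_elim (simp add: L0_C_SUP_dense[OF g h])
  from AE_pair_commute[OF this] show ?thesis
    by eventually_elim (auto simp: sup_dist_def frozen_dist_def intro!: nn_integral_cong_AE)
qed

lemma sup_dist_triangle:
  fixes a b c :: "'r \<times> 'o \<Rightarrow> 'x \<Rightarrow> real"
  assumes "a \<in> L0_C (R \<Otimes>\<^sub>M N)" "b \<in> L0_C (R \<Otimes>\<^sub>M N)" "c \<in> L0_C (R \<Otimes>\<^sub>M N)" "\<eta> \<in> space N"
  shows "sup_dist a c \<eta> \<le> sup_dist a b \<eta> + sup_dist b c \<eta>"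
proof -
  have m: "(\<lambda>r. SUP x. ennreal \<bar>g (r, \<eta>) x - h (r, \<eta>) x\<bar>) \<in> borel_measurable R"
    if "g \<in> L0_C (R \<Otimes>\<^sub>M N)" "h \<in> L0_C (R \<Otimes>\<^sub>M N)" for g h :: "'r \<times> 'o \<Rightarrow> 'x \<Rightarrow> real"
    by (rule measurable_compose[OF measurable_Pair2'[OF assms(4)] SUP_measurable[OF that]])
  note [measurable] = m[OF assms(1,2)] m[OF assms(2,3)]
  have "(SUP x. ennreal \<bar>a z x - c z x\<bar>) \<le> (SUP x. ennreal \<bar>a z x - b z x\<bar>) + (SUP x. ennreal \<bar>b z x - c z x\<bar>)" for z
  proof (rule SUP_least)
    fix x
    have "ennreal \<bar>a z x - c z x\<bar> \<le> ennreal \<bar>a z x - b z x\<bar> + ennreal \<bar>b z x - c z x\<bar>"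
      by (subst ennreal_plus[symmetric]) (auto intro!: ennreal_leI simp del: ennreal_plus)
    also have "\<dots> \<le> (SUP x. ennreal \<bar>a z x - b z x\<bar>) + (SUP x. ennreal \<bar>b z x - c z x\<bar>)"
      by (intro add_mono SUP_upper) auto
    finally show "ennreal \<bar>a z x - c z x\<bar> \<le> \<dots>" .
  qed
  then have "sup_dist a c \<eta> \<le> (\<integral>\<^sup>+ r. w r * (SUP x. ennreal \<bar>a (r, \<eta>) x - b (r, \<eta>) x\<bar>)
      + w r * (SUP x. ennreal \<bar>b (r, \<eta>) x - c (r, \<eta>) x\<bar>) \<partial>R)"
    unfolding sup_dist_def distrib_left[symmetric] by (intro nn_integral_mono mult_left_mono) auto
  also have "\<dots> = sup_dist a b \<eta> + sup_dist b c \<eta>"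
    unfolding sup_dist_def by (intro nn_integral_add) measurable
  finally show ?thesis .
qed

lemma sup_dist_commute: "sup_dist g h = sup_dist h g"
  by (simp add: sup_dist_def abs_minus_commute fun_eq_iff)

lemma fields_N:
  "f \<in> L0_C (R \<Otimes>\<^sub>M N)" "f_dec \<in> L0_C (R \<Otimes>\<^sub>M N)" "f_cond \<in> L0_C (R \<Otimes>\<^sub>M N)"
  using L0_C_mono[OF subalgebra_times[OF sub_F] f] L0_C_mono[OF subalgebra_times[OF sub_G] f_cond] f_dec
  by auto

sublocale NG: finite_measure_subalgebra N G
  by unfold_locales (rule sub_G)

sublocale RNG: finite_measure_subalgebra "R \<Otimes>\<^sub>M N" "R \<Otimes>\<^sub>M G"
  by unfold_locales (rule subalgebra_times[OF sub_G])

text \<open>Freezing applied to \<open>p\<close>-th powers of distances. The right-hand side depends on \<open>I\<close> only through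
its law, so for a \<open>G\<close>-measurable \<open>g\<close> the fields driven by \<open>I0\<close> and by \<open>I1\<close> are at the same conditional
distance from \<open>g\<close>. The case \<open>A = F\<close> is used with \<open>g = f\<close>.\<close>

lemma nn_cond_exp_sup_dist:
  fixes g h :: "'r \<times> 'o \<Rightarrow> 'x \<Rightarrow> real"
  assumes A: "subalgebra N A" and ind: "independent_with_law N A I \<mu>"
    and g: "g \<in> L0_C (R \<Otimes>\<^sub>M A)" and h: "h \<in> L0_C (R \<Otimes>\<^sub>M N)"
    and \<phi>A: "\<And>x. \<phi> x \<in> borel_measurable ((R \<Otimes>\<^sub>M A) \<Otimes>\<^sub>M \<mu>)"
    and h_eq: "\<And>x. AE z in R \<Otimes>\<^sub>M N. h z x = \<phi> x (z, I (snd z))"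
  shows "AE \<eta> in N. nn_cond_exp N A (\<lambda>\<eta>. enn_powr (sup_dist g h \<eta>) p) \<eta>
      = (\<integral>\<^sup>+ y. enn_powr (frozen_dist g (\<eta>, y)) p \<partial>\<mu>)"
proof -
  interpret NA: finite_measure_subalgebra N A by unfold_locales (rule A)
  have gN: "g \<in> L0_C (R \<Otimes>\<^sub>M N)" by (rule L0_C_mono[OF subalgebra_times[OF A] g])
  have [measurable]: "frozen_dist g \<in> borel_measurable (A \<Otimes>\<^sub>M \<mu>)"
    using g \<phi>A by (intro frozen_dist_measurable) (auto simp: L0_C_def)
  have [measurable]: "frozen_dist g \<in> borel_measurable (N \<Otimes>\<^sub>M \<mu>)"
    by (rule measurable_subalgebra_pair[OF A]) measurable
  have [measurable]: "I \<in> N \<rightarrow>\<^sub>M \<mu>" using ind by (simp add: independent_with_law_def)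
  note [measurable] = sup_dist_measurable[OF gN h]
  have "AE \<eta> in N. nn_cond_exp N A (\<lambda>\<eta>. enn_powr (sup_dist g h \<eta>) p) \<eta>
      = nn_cond_exp N A (\<lambda>\<eta>. enn_powr (frozen_dist g (\<eta>, I \<eta>)) p) \<eta>"
  proof (rule NA.nn_cond_exp_cong)
    show "AE \<eta> in N. enn_powr (sup_dist g h \<eta>) p = enn_powr (frozen_dist g (\<eta>, I \<eta>)) p"
      using sup_dist_eq_frozen_dist[OF gN h h_eq] by eventually_elim simp
  qed measurable
  moreover have "AE \<eta> in N. nn_cond_exp N A (\<lambda>\<eta>. enn_powr (frozen_dist g (\<eta>, I \<eta>)) p) \<eta>
      = (\<integral>\<^sup>+ y. enn_powr (frozen_dist g (\<eta>, y)) p \<partial>\<mu>)"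
    using nn_cond_exp_independent[OF N.prob_space_axioms \<mu>.prob_space_axioms A ind,
        of "\<lambda>z. enn_powr (frozen_dist g z) p"] by simp
  ultimately show ?thesis by eventually_elim simp
qed

text \<open>The triangle inequality through \<open>f_cond\<close>: both resulting terms have the same conditional
expectation by \<open>nn_cond_exp_sup_dist\<close>.\<close>

lemma cond_exp_dec_le:
  assumes "1 \<le> p"
  shows "AE \<eta> in N. nn_cond_exp N G (\<lambda>\<eta>. enn_powr (sup_dist f f_dec \<eta>) p) \<eta>
    \<le> ennreal (2 powr p) * nn_cond_exp N G (\<lambda>\<eta>. enn_powr (sup_dist f f_cond \<eta>) p) \<eta>"
proof -
  note [measurable] = sup_dist_measurable[OF fields_N(1) fields_N(2)]
    sup_dist_measurable[OF fields_N(1) fields_N(3)] sup_dist_measurable[OF fields_N(3) fields_N(2)]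
  let ?E = "nn_cond_exp N G" and ?c = "ennreal (2 powr (p - 1))"
  let ?X = "\<lambda>\<eta>. enn_powr (sup_dist f f_cond \<eta>) p" and ?Y = "\<lambda>\<eta>. enn_powr (sup_dist f_cond f_dec \<eta>) p"
  have indep1_G: "independent_with_law N G I1 \<mu>"
    using indep1 sub_GF by (auto simp: independent_with_law_def subalgebra_def)
  have "AE \<eta> in N. ?E (\<lambda>\<eta>. enn_powr (sup_dist f f_dec \<eta>) p) \<eta> \<le> ?E (\<lambda>\<eta>. ?c * (?X \<eta> + ?Y \<eta>)) \<eta>"
  proof (rule NG.nn_cond_exp_mono)
    show "AE \<eta> in N. enn_powr (sup_dist f f_dec \<eta>) p \<le> ?c * (?X \<eta> + ?Y \<eta>)"
    proof (rule AE_I2)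
      fix \<eta> assume "\<eta> \<in> space N"
      then have "enn_powr (sup_dist f f_dec \<eta>) p \<le> enn_powr (sup_dist f f_cond \<eta> + sup_dist f_cond f_dec \<eta>) p"
        using assms by (intro enn_powr_mono sup_dist_triangle fields_N) auto
      also have "\<dots> \<le> ?c * (?X \<eta> + ?Y \<eta>)" by (rule enn_powr_add_le[OF assms])
      finally show "enn_powr (sup_dist f f_dec \<eta>) p \<le> ?c * (?X \<eta> + ?Y \<eta>)" .
    qed
  qed measurable
  moreover have "AE \<eta> in N. ?c * ?E (\<lambda>\<eta>. ?X \<eta> + ?Y \<eta>) \<eta> = ?E (\<lambda>\<eta>. ?c * (?X \<eta> + ?Y \<eta>)) \<eta>"
    by (rule NG.nn_cond_exp_prod) measurable
  moreover have "AE \<eta> in N. ?E ?X \<eta> + ?E ?Y \<eta> = ?E (\<lambda>\<eta>. ?X \<eta> + ?Y \<eta>) \<eta>"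
    by (rule NG.nn_cond_exp_sum) measurable
  moreover have "AE \<eta> in N. ?E ?X \<eta> = (\<integral>\<^sup>+ y. enn_powr (frozen_dist f_cond (\<eta>, y)) p \<partial>\<mu>)"
    using nn_cond_exp_sup_dist[OF sub_G indep0 f_cond fields_N(1) \<phi> f_eq] by (simp add: sup_dist_commute)
  moreover have "AE \<eta> in N. ?E ?Y \<eta> = (\<integral>\<^sup>+ y. enn_powr (frozen_dist f_cond (\<eta>, y)) p \<partial>\<mu>)"
    by (rule nn_cond_exp_sup_dist[OF sub_G indep1_G f_cond fields_N(2) \<phi> f_dec_eq])
  ultimately show ?thesis
  proof eventually_elim
    case (elim \<eta>)
    have "?E (\<lambda>\<eta>. enn_powr (sup_dist f f_dec \<eta>) p) \<eta> \<le> ?c * (?E ?X \<eta> + ?E ?X \<eta>)"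
      using elim by simp
    also have "\<dots> = (?c * ennreal 2) * ?E ?X \<eta>"
      by (simp add: mult_2[symmetric] mult.assoc)
    also have "?c * ennreal 2 = ennreal (2 powr p)"
      by (subst ennreal_mult[symmetric]) (auto simp: powr_diff)
    finally show ?case .
  qed
qed

text \<open>Freezing the positive and the negative part of \<open>f\<close> separately; \<open>real_cond_exp\<close> is the difference
of their conditional expectations, as the Bochner integral is the difference of the two integrals.\<close>

lemma f_cond_eq_integral:
  "AE z in R \<Otimes>\<^sub>M N. integrable \<mu> (\<lambda>y. \<phi> x (z, y)) \<and> f_cond z x = (\<integral>y. \<phi> x (z, y) \<partial>\<mu>)"
proof -
  let ?RN = "R \<Otimes>\<^sub>M N" and ?RG = "R \<Otimes>\<^sub>M G"
  note ind = independent_with_law_times[OF R.prob_space_axioms N.prob_space_axioms sub_G indep0]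
  note freeze = nn_cond_exp_independent[OF RN.prob_space_axioms \<mu>.prob_space_axioms subalgebra_times[OF sub_G] ind]
  note integ = nn_integral_independent[OF RN.prob_space_axioms \<mu>.prob_space_axioms subalgebra_times[OF sub_G] ind]
  note [measurable] = \<phi>[of x]
  have [measurable]: "(\<lambda>z. f z x) \<in> borel_measurable ?RN" using f_int[of x] by auto
  have p: "AE z in ?RN. nn_cond_exp ?RN ?RG (\<lambda>z. ennreal (c * f z x)) z = (\<integral>\<^sup>+ y. ennreal (c * \<phi> x (z, y)) \<partial>\<mu>)" for c
  proof -
    have "AE z in ?RN. nn_cond_exp ?RN ?RG (\<lambda>z. ennreal (c * f z x)) z
        = nn_cond_exp ?RN ?RG (\<lambda>z. ennreal (c * \<phi> x (z, I0 (snd z)))) z"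
    proof (rule RNG.nn_cond_exp_cong)
      show "AE z in ?RN. ennreal (c * f z x) = ennreal (c * \<phi> x (z, I0 (snd z)))"
        using f_eq[of x] by eventually_elim simp
    qed measurable
    moreover have "AE z in ?RN. nn_cond_exp ?RN ?RG (\<lambda>z. ennreal (c * \<phi> x (z, I0 (snd z)))) z
        = (\<integral>\<^sup>+ y. ennreal (c * \<phi> x (z, y)) \<partial>\<mu>)"
      using freeze[of "\<lambda>p. ennreal (c * \<phi> x p)"] by simp
    ultimately show ?thesis by eventually_elim simp
  qed
  have "(\<integral>\<^sup>+ z. \<integral>\<^sup>+ y. ennreal \<bar>\<phi> x (z, y)\<bar> \<partial>\<mu> \<partial>?RN) = (\<integral>\<^sup>+ z. ennreal \<bar>\<phi> x (z, I0 (snd z))\<bar> \<partial>?RN)"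
    using integ[of "\<lambda>p. ennreal \<bar>\<phi> x p\<bar>"] by simp
  also have "\<dots> = (\<integral>\<^sup>+ z. ennreal \<bar>f z x\<bar> \<partial>?RN)"
    using f_eq[of x] by (intro nn_integral_cong_AE) (auto elim!: eventually_mono)
  also have "\<dots> \<noteq> \<infinity>"
    using f_int[of x] by (auto simp: integrable_iff_bounded)
  finally have "AE z in ?RN. (\<integral>\<^sup>+ y. ennreal \<bar>\<phi> x (z, y)\<bar> \<partial>\<mu>) \<noteq> \<infinity>"
    by (intro nn_integral_PInf_AE) measurable
  then show ?thesis
    using p[of 1] p[of "-1"] f_cond_eq[of x] AE_space
  proof eventually_elim
    case (elim z)
    have [measurable]: "(\<lambda>y. \<phi> x (z, y)) \<in> borel_measurable \<mu>"
      using elim(5) by measurable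
    have "integrable \<mu> (\<lambda>y. \<phi> x (z, y))"
      using elim(1) by (intro integrableI_bounded) (auto simp: less_top)
    with elim show ?case
      by (simp add: real_cond_exp_def real_lebesgue_integral_def)
  qed
qed

text \<open>Since \<open>f_cond\<close> is a mean over \<open>y\<close>, the distance from \<open>f\<close> to \<open>f_cond\<close> is at most the mean of
the frozen distances from \<open>f\<close>. Here \<open>f\<close> itself is frozen, which is why \<open>I1\<close> has to be independent
of \<open>F\<close> and not only of \<open>G\<close>.\<close>

lemma cond_exp_cond_le:
  assumes p: "1 \<le> p"
  shows "AE \<eta> in N. nn_cond_exp N G (\<lambda>\<eta>. enn_powr (sup_dist f f_cond \<eta>) p) \<eta>
    \<le> nn_cond_exp N G (\<lambda>\<eta>. enn_powr (sup_dist f f_dec \<eta>) p) \<eta>"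
proof -
  note [measurable] = sup_dist_measurable[OF fields_N(1) fields_N(2)]
    sup_dist_measurable[OF fields_N(1) fields_N(3)]
  have fx [measurable]: "(\<lambda>z. f z x) \<in> borel_measurable (R \<Otimes>\<^sub>M F)" "(\<lambda>z. f z x) \<in> borel_measurable (R \<Otimes>\<^sub>M N)" for x
    using f fields_N(1) by (auto simp: L0_C_def)
  have frozen_F: "frozen_dist f \<in> borel_measurable (F \<Otimes>\<^sub>M \<mu>)"
    by (intro frozen_dist_measurable \<phi>_measurable fx)
  have frozen_N [measurable]: "frozen_dist f \<in> borel_measurable (N \<Otimes>\<^sub>M \<mu>)"
    by (intro frozen_dist_measurable \<phi>_measurable fx)
  \<comment> \<open>The pointwise bound before integration in time.\<close>
  have "AE z in R \<Otimes>\<^sub>M N. (SUP x. ennreal \<bar>f z x - f_cond z x\<bar>)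
      \<le> (\<integral>\<^sup>+ y. (SUP x\<in>D. ennreal \<bar>f z x - \<phi> x (z, y)\<bar>) \<partial>\<mu>)"
  proof -
    have "AE z in R \<Otimes>\<^sub>M N. \<forall>x\<in>D. integrable \<mu> (\<lambda>y. \<phi> x (z, y)) \<and> f_cond z x = (\<integral>y. \<phi> x (z, y) \<partial>\<mu>)"
      using f_cond_eq_integral D(1) by (subst AE_ball_countable) auto
    then show ?thesis
      using AE_space
    proof eventually_elim
      case (elim z)
      have "ennreal \<bar>f z x - f_cond z x\<bar> \<le> (\<integral>\<^sup>+ y. (SUP x\<in>D. ennreal \<bar>f z x - \<phi> x (z, y)\<bar>) \<partial>\<mu>)" if "x \<in> D" for x
      proof -
        have int [simp]: "integrable \<mu> (\<lambda>y. \<phi> x (z, y))" using elim that by blast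
        have "\<bar>f z x - f_cond z x\<bar> = \<bar>\<integral>y. f z x - \<phi> x (z, y) \<partial>\<mu>\<bar>"
          using elim that by (simp add: \<mu>.prob_space)
        then have "ennreal \<bar>f z x - f_cond z x\<bar> \<le> (\<integral>\<^sup>+ y. ennreal \<bar>f z x - \<phi> x (z, y)\<bar> \<partial>\<mu>)"
          using integral_norm_bound_ennreal[of \<mu> "\<lambda>y. f z x - \<phi> x (z, y)"] by simp
        also have "\<dots> \<le> (\<integral>\<^sup>+ y. (SUP x\<in>D. ennreal \<bar>f z x - \<phi> x (z, y)\<bar>) \<partial>\<mu>)"
          using that by (intro nn_integral_mono SUP_upper)
        finally show ?thesis .
      qed
      then show ?case
        using L0_C_SUP_dense[OF fields_N(1,3) elim(2)] by (auto intro: SUP_least)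
    qed
  qed
  from AE_pair_commute[OF this]
  have "AE \<eta> in N. enn_powr (sup_dist f f_cond \<eta>) p \<le> (\<integral>\<^sup>+ y. enn_powr (frozen_dist f (\<eta>, y)) p \<partial>\<mu>)"
    using AE_space
  proof eventually_elim
    case (elim \<eta>)
    have "(\<lambda>q. w (fst q) * (SUP x\<in>D. ennreal \<bar>f (fst q, \<eta>) x - \<phi> x ((fst q, \<eta>), snd q)\<bar>)) \<in> borel_measurable (R \<Otimes>\<^sub>M \<mu>)"
    proof (intro borel_measurable_times_ennreal borel_measurable_SUP D(1))
      fix x
      have "(\<lambda>q. (fst q, \<eta>)) \<in> R \<Otimes>\<^sub>M \<mu> \<rightarrow>\<^sub>M R \<Otimes>\<^sub>M N" using elim(2) by measurable
      then show "(\<lambda>q. ennreal \<bar>f (fst q, \<eta>) x - \<phi> x ((fst q, \<eta>), snd q)\<bar>) \<in> borel_measurable (R \<Otimes>\<^sub>M \<mu>)"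
        by (intro measurable_compose[OF _ measurable_ennreal] borel_measurable_abs borel_measurable_diff
            measurable_compose[OF _ fx(2)] measurable_compose[OF _ \<phi>_measurable(2)] measurable_Pair[OF _ measurable_snd])
    qed measurable
    note m = this
    interpret R\<mu>: pair_sigma_finite R \<mu> ..
    \<comment> \<open>Integrate over time, exchange the two integrals, and apply Jensen's inequality to \<open>\<mu>\<close>.\<close>
    have "sup_dist f f_cond \<eta> \<le> (\<integral>\<^sup>+ r. w r * (\<integral>\<^sup>+ y. (SUP x\<in>D. ennreal \<bar>f (r, \<eta>) x - \<phi> x ((r, \<eta>), y)\<bar>) \<partial>\<mu>) \<partial>R)"
      unfolding sup_dist_def using elim(1) by (intro nn_integral_mono_AE) (auto elim!: eventually_mono intro!: mult_left_mono)
    also have "\<dots> = (\<integral>\<^sup>+ r. \<integral>\<^sup>+ y. w r * (SUP x\<in>D. ennreal \<bar>f (r, \<eta>) x - \<phi> x ((r, \<eta>), y)\<bar>) \<partial>\<mu> \<partial>R)"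
    proof (rule nn_integral_cong)
      fix r assume r: "r \<in> space R"
      have "(\<lambda>y. SUP x\<in>D. ennreal \<bar>f (r, \<eta>) x - \<phi> x ((r, \<eta>), y)\<bar>) \<in> borel_measurable \<mu>"
      proof (intro borel_measurable_SUP D(1))
        fix x
        have "(r, \<eta>) \<in> space (R \<Otimes>\<^sub>M N)" using r elim(2) by (simp add: space_pair_measure)
        then show "(\<lambda>y. ennreal \<bar>f (r, \<eta>) x - \<phi> x ((r, \<eta>), y)\<bar>) \<in> borel_measurable \<mu>"
          by measurable
      qed
      then show "w r * (\<integral>\<^sup>+ y. (SUP x\<in>D. ennreal \<bar>f (r, \<eta>) x - \<phi> x ((r, \<eta>), y)\<bar>) \<partial>\<mu>)
        = (\<integral>\<^sup>+ y. w r * (SUP x\<in>D. ennreal \<bar>f (r, \<eta>) x - \<phi> x ((r, \<eta>), y)\<bar>) \<partial>\<mu>)"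
        by (rule nn_integral_cmult[symmetric])
    qed
    also have "\<dots> = (\<integral>\<^sup>+ y. frozen_dist f (\<eta>, y) \<partial>\<mu>)"
      unfolding frozen_dist_def prod.case using m by (intro R\<mu>.Fubini'[symmetric]) (simp add: split_beta')
    finally have "enn_powr (sup_dist f f_cond \<eta>) p \<le> enn_powr (\<integral>\<^sup>+ y. frozen_dist f (\<eta>, y) \<partial>\<mu>) p"
      using p by (intro enn_powr_mono) auto
    also have "\<dots> \<le> (\<integral>\<^sup>+ y. enn_powr (frozen_dist f (\<eta>, y)) p \<partial>\<mu>)"
      using elim(2) p by (intro \<mu>.enn_powr_nn_integral_le) measurable
    finally show ?case .
  qed
  moreover have "AE \<eta> in N. nn_cond_exp N F (\<lambda>\<eta>. enn_powr (sup_dist f f_dec \<eta>) p) \<eta>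
      = (\<integral>\<^sup>+ y. enn_powr (frozen_dist f (\<eta>, y)) p \<partial>\<mu>)"
    by (rule nn_cond_exp_sup_dist[OF sub_F indep1 f fields_N(2) \<phi>_measurable(1) f_dec_eq])
  ultimately have "AE \<eta> in N. enn_powr (sup_dist f f_cond \<eta>) p \<le> nn_cond_exp N F (\<lambda>\<eta>. enn_powr (sup_dist f f_dec \<eta>) p) \<eta>"
    by eventually_elim simp
  then have "AE \<eta> in N. nn_cond_exp N G (\<lambda>\<eta>. enn_powr (sup_dist f f_cond \<eta>) p) \<eta>
      \<le> nn_cond_exp N G (nn_cond_exp N F (\<lambda>\<eta>. enn_powr (sup_dist f f_dec \<eta>) p)) \<eta>"
    by (rule NG.nn_cond_exp_mono) measurable
  moreover have "AE \<eta> in N. nn_cond_exp N G (\<lambda>\<eta>. enn_powr (sup_dist f f_dec \<eta>) p) \<eta>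
      = nn_cond_exp N G (nn_cond_exp N F (\<lambda>\<eta>. enn_powr (sup_dist f f_dec \<eta>) p)) \<eta>"
    by (rule NG.nn_cond_exp_nested_subalg[OF sub_F sub_GF]) measurable
  ultimately show ?thesis by eventually_elim simp
qed

end

section \<open>Brownian increments inside and outside an interval\<close>

abbreviation path_space :: "real \<Rightarrow> (real \<Rightarrow> real ^ 'd) measure" where
  "path_space T \<equiv> \<Pi>\<^sub>M r\<in>{0..T}. borel"

text \<open>Inner and outer paths are defined on all of \<open>[0, T]\<close> by clamping the time, so that their sum is the
path of \<open>B\<close> up to its initial value.\<close>

definition inner_path :: "real \<Rightarrow> real \<Rightarrow> real \<Rightarrow> (real \<Rightarrow> 'o \<Rightarrow> real ^ 'd) \<Rightarrow> 'o \<Rightarrow> real \<Rightarrow> real ^ 'd" where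
  "inner_path T s t B \<omega> = (\<lambda>r\<in>{0..T}. B (min (max r s) t) \<omega> - B s \<omega>)"

definition outer_path :: "real \<Rightarrow> real \<Rightarrow> real \<Rightarrow> (real \<Rightarrow> 'o \<Rightarrow> real ^ 'd) \<Rightarrow> 'o \<Rightarrow> real \<Rightarrow> real ^ 'd" where
  "outer_path T s t B \<omega> = (\<lambda>r\<in>{0..T}. (B (min r s) \<omega> - B 0 \<omega>) + (B (max r t) \<omega> - B t \<omega>))"

text \<open>Beyond index \<open>n\<close> the enumeration is constant: the definition of Brownian motion asks for
monotone time sequences defined on all natural numbers.\<close>

lemma finite_real_set_enumeration:
  fixes A :: "real set"
  assumes "finite A" "A \<noteq> {}"
  obtains n and \<tau> :: "nat \<Rightarrow> real" where "mono \<tau>" "range \<tau> = A" "\<tau> ` {..n} = A" "\<And>k. k < n \<Longrightarrow> \<tau> k < \<tau> (Suc k)"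
proof -
  define xs where "xs = sorted_list_of_set A"
  define n where "n = length xs - 1"
  define \<tau> where "\<tau> k = xs ! min k n" for k
  have xs: "sorted_wrt (<) xs" "set xs = A" "xs \<noteq> []"
    using assms by (auto simp: xs_def)
  then have len: "length xs = Suc n" by (cases xs) (auto simp: n_def)
  have sorted: "sorted xs" by (simp add: xs_def)
  have "mono \<tau>"
    unfolding \<tau>_def using len by (intro monoI sorted_nth_mono[OF sorted]) auto
  moreover have *: "\<tau> ` {..n} = A"
    unfolding xs(2)[symmetric] set_conv_nth \<tau>_def len by (auto simp: image_def less_Suc_eq_le)
  moreover have "range \<tau> = A"
  proof
    show "range \<tau> \<subseteq> A" unfolding xs(2)[symmetric] \<tau>_def using len by (auto intro!: nth_mem)
    show "A \<subseteq> range \<tau>" using * by auto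
  qed
  moreover have "\<tau> k < \<tau> (Suc k)" if "k < n" for k
    unfolding \<tau>_def using that len sorted_wrt_nth_less[OF xs(1), of k "Suc k"] by (simp add: min_def)
  ultimately show thesis using that by blast
qed

lemma distr_brownian_increments:
  assumes BM: "brownian_motion T N W" and "prob_space N"
    and \<tau>: "mono \<tau>" "range \<tau> \<subseteq> {0..T}" "\<And>k. k < n \<Longrightarrow> \<tau> k < \<tau> (Suc k)" and n: "0 < n"
  shows "distr N (\<Pi>\<^sub>M k\<in>{..<n}. borel) (\<lambda>\<omega>. \<lambda>k\<in>{..<n}. W (\<tau> (Suc k)) \<omega> - W (\<tau> k) \<omega>)
    = (\<Pi>\<^sub>M k\<in>{..<n}. density lborel (\<lambda>x. ennreal (\<Prod>i\<in>UNIV. normal_density 0 (sqrt (\<tau> (Suc k) - \<tau> k)) (x $ i))))"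
proof -
  interpret prob_space N by fact
  have W: "W r \<in> borel_measurable N" if "r \<in> {0..T}" for r
    using BM that by (simp add: brownian_motion_def)
  have ind: "indep_vars (\<lambda>_. borel) (\<lambda>k \<omega>. W (\<tau> (Suc k)) \<omega> - W (\<tau> k) \<omega>) {..<n}"
    using BM \<tau> by (simp add: brownian_motion_def)
  have "distr N (\<Pi>\<^sub>M k\<in>{..<n}. borel) (\<lambda>\<omega>. \<lambda>k\<in>{..<n}. W (\<tau> (Suc k)) \<omega> - W (\<tau> k) \<omega>)
    = (\<Pi>\<^sub>M k\<in>{..<n}. distr N borel (\<lambda>\<omega>. W (\<tau> (Suc k)) \<omega> - W (\<tau> k) \<omega>))"
  proof (rule indep_vars_iff_distr_eq_PiM'[THEN iffD1, OF _ _ ind])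
    show "{..<n} \<noteq> {}" using n by auto
    show "(\<lambda>\<omega>. W (\<tau> (Suc k)) \<omega> - W (\<tau> k) \<omega>) \<in> borel_measurable N" for k
      using \<tau>(2) by (intro borel_measurable_diff W) blast+
  qed
  also have "\<dots> = (\<Pi>\<^sub>M k\<in>{..<n}. density lborel (\<lambda>x. ennreal (\<Prod>i\<in>UNIV. normal_density 0 (sqrt (\<tau> (Suc k) - \<tau> k)) (x $ i))))"
  proof (rule PiM_cong[OF refl])
    fix k assume "k \<in> {..<n}"
    then have "distributed N lborel (\<lambda>\<omega>. W (\<tau> (Suc k)) \<omega> - W (\<tau> k) \<omega>)
        (\<lambda>x. ennreal (\<Prod>i\<in>UNIV. normal_density 0 (sqrt (\<tau> (Suc k) - \<tau> k)) (x $ i)))"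
      using BM \<tau>(2) \<tau>(3)[of k] by (simp add: brownian_motion_def image_subset_iff)
    from distributed_distr_eq_density[OF this]
    show "distr N borel (\<lambda>\<omega>. W (\<tau> (Suc k)) \<omega> - W (\<tau> k) \<omega>)
        = density lborel (\<lambda>x. ennreal (\<Prod>i\<in>UNIV. normal_density 0 (sqrt (\<tau> (Suc k) - \<tau> k)) (x $ i)))"
      by (simp add: distr_cong[OF refl sets_lborel[symmetric] refl])
  qed
  finally show ?thesis .
qed

definition increment_sum :: "(nat \<Rightarrow> real) \<Rightarrow> nat set \<Rightarrow> (nat \<Rightarrow> real ^ 'd) \<Rightarrow> real \<Rightarrow> real ^ 'd" where
  "increment_sum \<tau> K x r = (\<Sum>k\<in>{k\<in>K. \<tau> (Suc k) \<le> r}. x k)"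

lemma increment_sum_measurable: "(\<lambda>x. increment_sum \<tau> K x r) \<in> borel_measurable (\<Pi>\<^sub>M k\<in>K. borel)"
  unfolding increment_sum_def by (intro borel_measurable_sum measurable_component_singleton) auto

text \<open>If \<open>g\<close> is constant on all intervals outside the block \<open>K\<close>, then the increments over \<open>K\<close> alone
reproduce \<open>g\<close>. It is applied with \<open>g\<close> a clamped path and \<open>K\<close> the intervals inside, or those outside, \<open>(s, t]\<close>.\<close>

lemma telescope_over_block:
  fixes g :: "real \<Rightarrow> real ^ 'd"
  assumes \<tau>: "mono \<tau>" "\<And>k. k < n \<Longrightarrow> \<tau> k < \<tau> (Suc k)" and r: "r \<in> \<tau> ` {..n}"
    and K: "K \<subseteq> {..<n}" and const: "\<And>k. k < n \<Longrightarrow> k \<notin> K \<Longrightarrow> g (\<tau> (Suc k)) = g (\<tau> k)"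
    and x: "\<And>k. k \<in> K \<Longrightarrow> x k = g (\<tau> (Suc k)) - g (\<tau> k)"
  shows "increment_sum \<tau> K x r = g r - g (\<tau> 0)"
proof -
  obtain m where m: "m \<le> n" "r = \<tau> m" using r by auto
  have iff: "\<tau> (Suc k) \<le> r \<longleftrightarrow> k < m" if "k < n" for k
  proof
    assume "k < m" then show "\<tau> (Suc k) \<le> r" unfolding m(2) by (intro monoD[OF \<tau>(1)]) simp
  next
    assume "\<tau> (Suc k) \<le> r"
    show "k < m"
    proof (rule ccontr)
      assume "\<not> k < m"
      then have "r \<le> \<tau> k" unfolding m(2) by (intro monoD[OF \<tau>(1)]) simp
      with \<tau>(2)[OF that] \<open>\<tau> (Suc k) \<le> r\<close> show False by simp
    qed
  qed
  have "increment_sum \<tau> K x r = (\<Sum>k\<in>K \<inter> {..<m}. g (\<tau> (Suc k)) - g (\<tau> k))"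
    unfolding increment_sum_def using K iff x by (intro sum.cong) auto
  also have "\<dots> = (\<Sum>k<m. g (\<tau> (Suc k)) - g (\<tau> k))"
  proof (intro sum.mono_neutral_left ballI)
    fix k assume "k \<in> {..<m} - K \<inter> {..<m}"
    then show "g (\<tau> (Suc k)) - g (\<tau> k) = 0" using const[of k] m(1) by auto
  qed auto
  also have "\<dots> = g r - g (\<tau> 0)"
    unfolding m(2) by (rule sum_lessThan_telescope)
  finally show ?thesis .
qed

text \<open>A partition containing \<open>s\<close> and \<open>t\<close>: each of its intervals lies entirely inside or entirely outside
\<open>(s, t]\<close>, so its increments split into two blocks, and the inner and outer path at the times in \<open>J\<close>
are functions of one block each.\<close>

locale partition_of_interval =
  fixes T s t :: real and J :: "real set" and n :: nat and \<tau> :: "nat \<Rightarrow> real"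
  assumes st: "0 \<le> s" "s < t" "t \<le> T"
    and \<tau>: "mono \<tau>" "range \<tau> \<subseteq> {0..T}" "\<And>k. k < n \<Longrightarrow> \<tau> k < \<tau> (Suc k)"
    and J: "J \<subseteq> \<tau> ` {..n}" "0 \<in> \<tau> ` {..n}" "s \<in> \<tau> ` {..n}" "t \<in> \<tau> ` {..n}"
begin

definition "inner_block = {k. k < n \<and> s \<le> \<tau> k \<and> \<tau> (Suc k) \<le> t}"

definition "outer_block = {..<n} - inner_block"

lemma \<tau>_0: "\<tau> 0 = 0"
proof -
  obtain m where "\<tau> m = 0" using J(2) by auto
  with monoD[OF \<tau>(1), of 0 m] \<tau>(2) show ?thesis by (auto simp: image_subset_iff intro: antisym)
qed

lemma no_point_between:
  assumes "v \<in> \<tau> ` {..n}" "k < n" shows "\<tau> (Suc k) \<le> v \<or> v \<le> \<tau> k"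
proof -
  obtain m where m: "v = \<tau> m" using assms by auto
  show ?thesis
    unfolding m using monoD[OF \<tau>(1), of "Suc k" m] monoD[OF \<tau>(1), of m k] by (cases "Suc k \<le> m") auto
qed

lemma J_le: "r \<in> J \<Longrightarrow> r \<in> {0..T}"
  using J(1) \<tau>(2) by blast

lemma inner_path_eq_increment_sum:
  assumes "r \<in> J"
  shows "inner_path T s t B \<omega> r = increment_sum \<tau> inner_block (\<lambda>k\<in>inner_block. B (\<tau> (Suc k)) \<omega> - B (\<tau> k) \<omega>) r"
proof -
  define g where "g v = B (min (max v s) t) \<omega>" for v
  have "increment_sum \<tau> inner_block (\<lambda>k\<in>inner_block. B (\<tau> (Suc k)) \<omega> - B (\<tau> k) \<omega>) r = g r - g (\<tau> 0)"
  proof (rule telescope_over_block[OF \<tau>(1,3)])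
    show "g (\<tau> (Suc k)) = g (\<tau> k)" if "k < n" "k \<notin> inner_block" for k
      using no_point_between[OF J(3) that(1)] no_point_between[OF J(4) that(1)] that \<tau>(3)[OF that(1)] st
      by (auto simp: g_def inner_block_def min_def max_def)
    show "(\<lambda>k\<in>inner_block. B (\<tau> (Suc k)) \<omega> - B (\<tau> k) \<omega>) k = g (\<tau> (Suc k)) - g (\<tau> k)" if "k \<in> inner_block" for k
      using that \<tau>(3)[of k] by (auto simp: g_def inner_block_def min_def max_def)
  qed (use assms J in \<open>auto simp: inner_block_def\<close>)
  then show ?thesis
    using J_le[OF assms] st by (simp add: inner_path_def g_def \<tau>_0)
qed

lemma outer_path_eq_increment_sum:
  assumes "r \<in> J"
  shows "outer_path T s t B \<omega> r = increment_sum \<tau> outer_block (\<lambda>k\<in>outer_block. B (\<tau> (Suc k)) \<omega> - B (\<tau> k) \<omega>) r"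
proof -
  define g where "g v = B (min v s) \<omega> + B (max v t) \<omega>" for v
  have "increment_sum \<tau> outer_block (\<lambda>k\<in>outer_block. B (\<tau> (Suc k)) \<omega> - B (\<tau> k) \<omega>) r = g r - g (\<tau> 0)"
  proof (rule telescope_over_block[OF \<tau>(1,3)])
    show "g (\<tau> (Suc k)) = g (\<tau> k)" if "k < n" "k \<notin> outer_block" for k
      using that \<tau>(3)[OF that(1)] by (auto simp: g_def inner_block_def outer_block_def min_def max_def)
    show "(\<lambda>k\<in>outer_block. B (\<tau> (Suc k)) \<omega> - B (\<tau> k) \<omega>) k = g (\<tau> (Suc k)) - g (\<tau> k)" if "k \<in> outer_block" for k
    proof -
      have k: "k < n" using that by (simp add: outer_block_def)
      show ?thesis
        using no_point_between[OF J(3) k] no_point_between[OF J(4) k] that \<tau>(3)[OF k] st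
        by (auto simp: g_def outer_block_def inner_block_def min_def max_def)
    qed
  qed (use assms J in \<open>auto simp: outer_block_def\<close>)
  then show ?thesis
    using J_le[OF assms] st by (simp add: outer_path_def g_def \<tau>_0)
qed

end

lemma partition_of_interval_exists:
  assumes "0 \<le> s" "s < t" "t \<le> T" "finite J" "J \<subseteq> {0..T}"
  obtains n \<tau> where "partition_of_interval T s t J n \<tau>" "0 < n"
proof -
  let ?A = "insert 0 (insert s (insert t J))"
  obtain n \<tau> where \<tau>: "mono \<tau>" "range \<tau> = ?A" "\<tau> ` {..n} = ?A" "\<And>k. k < n \<Longrightarrow> \<tau> k < \<tau> (Suc k)"
    by (rule finite_real_set_enumeration[of ?A]) (use assms(4) in auto)
  have "n \<noteq> 0"
  proof
    assume "n = 0"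
    have "s \<in> \<tau> ` {..n}" "t \<in> \<tau> ` {..n}" unfolding \<tau>(3) by auto
    with \<open>n = 0\<close> have "s = \<tau> 0" "t = \<tau> 0" by auto
    with assms show False by simp
  qed
  moreover have "partition_of_interval T s t J n \<tau>"
    using assms \<tau> by unfold_locales auto
  ultimately show thesis using that by blast
qed

lemma path_measurable:
  assumes "\<And>r. r \<in> {0..T} \<Longrightarrow> W r \<in> borel_measurable N" "0 \<le> s" "s < t" "t \<le> T"
  shows "inner_path T s t W \<in> N \<rightarrow>\<^sub>M path_space T" "outer_path T s t W \<in> N \<rightarrow>\<^sub>M path_space T"
  unfolding inner_path_def outer_path_def
  by (intro measurable_restrict borel_measurable_diff borel_measurable_add assms(1);
      use assms(2-4) in \<open>auto simp: min_def max_def\<close>)+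

lemma vimage_cylinder:
  assumes "\<And>\<omega>. X \<omega> \<in> extensional I" "J \<subseteq> I"
  shows "X -` prod_emb I (\<lambda>_. borel :: 'v::topological_space measure) J (Pi\<^sub>E J E) \<inter> \<Omega> = {\<omega>\<in>\<Omega>. \<forall>r\<in>J. X \<omega> r \<in> E r}"
  using assms by (auto simp: prod_emb_def PiE_iff)

lemma path_extensional:
  "inner_path T s t B \<omega> \<in> extensional {0..T}" "outer_path T s t B \<omega> \<in> extensional {0..T}"
  by (simp_all add: inner_path_def outer_path_def)

text \<open>Two laws on the path space agree if they agree on cylinder sets. On a cylinder set only finitely
many increments matter, and these are independent with prescribed normal densities.\<close>

lemma distr_inner_path_eq:
  fixes W :: "real \<Rightarrow> 'a \<Rightarrow> real ^ 'd" and V :: "real \<Rightarrow> 'b \<Rightarrow> real ^ 'd"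
  assumes "brownian_motion T M W" "prob_space M" "brownian_motion T N V" "prob_space N"
    and st: "0 \<le> s" "s < t" "t \<le> T"
  shows "distr M (path_space T) (inner_path T s t W) = distr N (path_space T) (inner_path T s t V)"
proof (rule measure_eqI_PiM_infinite)
  fix E :: "real \<Rightarrow> (real ^ 'd) set" and J assume finJ: "finite J" "J \<subseteq> {0..T}" and E: "\<And>r. r \<in> J \<Longrightarrow> E r \<in> sets borel"
  let ?C = "prod_emb {0..T} (\<lambda>_. borel) J (Pi\<^sub>E J E)"
  obtain n \<tau> where part: "partition_of_interval T s t J n \<tau>" and n: "0 < n"
    by (rule partition_of_interval_exists[OF st finJ])
  interpret partition_of_interval T s t J n \<tau> by fact
  define P where "P = (\<Pi>\<^sub>M k\<in>{..<n}. density lborel (\<lambda>x. ennreal (\<Prod>i\<in>UNIV. normal_density 0 (sqrt (\<tau> (Suc k) - \<tau> k)) ((x::real^'d) $ i))))"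
  define Y where "Y = {x\<in>space (\<Pi>\<^sub>M k\<in>{..<n}. (borel::(real^'d) measure)). \<forall>r\<in>J. increment_sum \<tau> inner_block (restrict x inner_block) r \<in> E r}"
  have sub: "inner_block \<subseteq> {..<n}" by (auto simp: inner_block_def)
  have Y: "Y \<in> sets (\<Pi>\<^sub>M k\<in>{..<n}. borel)"
    unfolding Y_def
  proof (rule sets.sets_Collect_finite_All[OF _ finJ(1)])
    fix r assume "r \<in> J"
    have "(\<lambda>x. increment_sum \<tau> inner_block (restrict x inner_block) r) \<in> borel_measurable (\<Pi>\<^sub>M k\<in>{..<n}. borel)"
      by (rule measurable_compose[OF measurable_restrict_subset[OF sub] increment_sum_measurable])
    from measurable_sets[OF this E[OF \<open>r \<in> J\<close>]]
    show "{x\<in>space (\<Pi>\<^sub>M k\<in>{..<n}. (borel::(real^'d) measure)). increment_sum \<tau> inner_block (restrict x inner_block) r \<in> E r} \<in> sets (\<Pi>\<^sub>M k\<in>{..<n}. borel)"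
      by (simp add: vimage_def Int_def conj_commute)
  qed
  have *: "emeasure (distr K (path_space T) (inner_path T s t B)) ?C = emeasure P Y"
    if BM: "brownian_motion T K B" and "prob_space K" for K :: "'k measure" and B :: "real \<Rightarrow> 'k \<Rightarrow> real ^ 'd"
  proof -
    let ?\<Delta> = "\<lambda>\<omega>. \<lambda>k\<in>{..<n}. B (\<tau> (Suc k)) \<omega> - B (\<tau> k) \<omega>"
    have B: "\<And>r. r \<in> {0..T} \<Longrightarrow> B r \<in> borel_measurable K"
      using BM by (simp add: brownian_motion_def)
    have \<Delta>: "?\<Delta> \<in> K \<rightarrow>\<^sub>M (\<Pi>\<^sub>M k\<in>{..<n}. borel)"
      using \<tau>(2) by (intro measurable_restrict borel_measurable_diff B) blast+
    have "?C \<in> sets (path_space T)"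
      using finJ E by (intro sets_PiM_I) auto
    then have "emeasure (distr K (path_space T) (inner_path T s t B)) ?C = emeasure K (inner_path T s t B -` ?C \<inter> space K)"
      using path_measurable(1)[OF B st] by (intro emeasure_distr)
    also have "inner_path T s t B -` ?C \<inter> space K = {\<omega>\<in>space K. \<forall>r\<in>J. inner_path T s t B \<omega> r \<in> E r}"
      by (rule vimage_cylinder[OF path_extensional(1) finJ(2)])
    also have "\<dots> = ?\<Delta> -` Y \<inter> space K"
    proof -
      have "restrict (?\<Delta> \<omega>) inner_block = (\<lambda>k\<in>inner_block. B (\<tau> (Suc k)) \<omega> - B (\<tau> k) \<omega>)" for \<omega>
        using sub by (auto simp: fun_eq_iff)
      then show ?thesis
        using measurable_space[OF \<Delta>] by (auto simp: Y_def inner_path_eq_increment_sum simp del: restrict_restrict)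
    qed
    also have "emeasure K (?\<Delta> -` Y \<inter> space K) = emeasure (distr K (\<Pi>\<^sub>M k\<in>{..<n}. borel) ?\<Delta>) Y"
      by (rule emeasure_distr[OF \<Delta> Y, symmetric])
    also have "distr K (\<Pi>\<^sub>M k\<in>{..<n}. borel) ?\<Delta> = P"
      unfolding P_def by (rule distr_brownian_increments[OF that \<tau> n])
    finally show ?thesis .
  qed
  show "emeasure (distr M (path_space T) (inner_path T s t W)) ?C = emeasure (distr N (path_space T) (inner_path T s t V)) ?C"
    by (simp add: *[OF assms(1,2)] *[OF assms(3,4)])
next
  show "finite_measure (distr M (path_space T) (inner_path T s t W))"
    using assms by (intro prob_space.finite_measure prob_space.prob_space_distr path_measurable)
      (auto simp: brownian_motion_def)
qed simp_all

text \<open>On cylinder sets, independence is that of functions of disjoint blocks of increments. The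
cylinder sets form an intersection-stable generator of the \<open>\<sigma>\<close>-algebra on paths, so it extends.\<close>

lemma outer_inner_path_independent:
  fixes W :: "real \<Rightarrow> 'a \<Rightarrow> real ^ 'd"
  assumes BM: "brownian_motion T M W" and "prob_space M"
    and st: "0 \<le> s" "s < t" "t \<le> T"
    and A: "A \<in> sets (path_space T)" and C: "C \<in> sets (path_space T)"
  shows "emeasure M {\<omega>\<in>space M. outer_path T s t W \<omega> \<in> A \<and> inner_path T s t W \<omega> \<in> C}
    = emeasure M (outer_path T s t W -` A \<inter> space M) * emeasure (distr M (path_space T) (inner_path T s t W)) C"
proof -
  interpret prob_space M by fact
  let ?O = "outer_path T s t W" and ?I = "inner_path T s t W" and ?\<Omega> = "\<Pi>\<^sub>E r\<in>{0..T}. space (borel :: (real^'d) measure)"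
  let ?gen = "prod_algebra {0..T} (\<lambda>_. borel :: (real^'d) measure)"
  have W: "\<And>r. r \<in> {0..T} \<Longrightarrow> W r \<in> borel_measurable M"
    using BM by (simp add: brownian_motion_def)
  note I = path_measurable(1)[OF W st] and O = path_measurable(2)[OF W st]
  have sets_eq: "{X -` A \<inter> space M |A. A \<in> sets (path_space T)} = sigma_sets (space M) {X -` A \<inter> space M |A. A \<in> ?gen}"
    if "X \<in> M \<rightarrow>\<^sub>M path_space T" for X :: "'a \<Rightarrow> real \<Rightarrow> real ^ 'd"
    unfolding sets_PiM using measurable_space[OF that] by (intro sigma_sets_vimage_commute) (auto simp: space_PiM)
  have gen_sets: "A \<in> ?gen \<Longrightarrow> A \<in> sets (path_space T)" for A :: "(real \<Rightarrow> real ^ 'd) set"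
    unfolding sets_PiM by (rule sigma_sets.Basic)
  have stable: "Int_stable {X -` A \<inter> space M |A. A \<in> ?gen}" for X :: "'a \<Rightarrow> real \<Rightarrow> real ^ 'd"
  proof (rule Int_stableI, clarify)
    fix a b :: "(real \<Rightarrow> real ^ 'd) set" assume "a \<in> ?gen" "b \<in> ?gen"
    then have "a \<inter> b \<in> ?gen" using Int_stable_prod_algebra by (auto simp: Int_stable_def)
    then show "\<exists>A. X -` a \<inter> space M \<inter> (X -` b \<inter> space M) = X -` A \<inter> space M \<and> A \<in> ?gen"
      by (intro exI[of _ "a \<inter> b"]) auto
  qed
  have "indep_set {?O -` A \<inter> space M |A. A \<in> ?gen} {?I -` A \<inter> space M |A. A \<in> ?gen}"
  proof (rule indep_setI)
    show "{?O -` A \<inter> space M |A. A \<in> ?gen} \<subseteq> events" "{?I -` A \<inter> space M |A. A \<in> ?gen} \<subseteq> events"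
      using measurable_sets[OF O gen_sets] measurable_sets[OF I gen_sets] by auto
  next
    fix a b assume "a \<in> {?O -` A \<inter> space M |A. A \<in> ?gen}" "b \<in> {?I -` A \<inter> space M |A. A \<in> ?gen}"
    then obtain A1 A2 where a: "a = ?O -` A1 \<inter> space M" "A1 \<in> ?gen" and b: "b = ?I -` A2 \<inter> space M" "A2 \<in> ?gen"
      by auto
    obtain J1 E1 where 1: "A1 = prod_emb {0..T} (\<lambda>_. borel) J1 (Pi\<^sub>E J1 E1)" "finite J1" "J1 \<subseteq> {0..T}" "\<And>r. r \<in> J1 \<Longrightarrow> E1 r \<in> sets borel"
      using prod_algebraE[OF a(2)] by metis
    obtain J2 E2 where 2: "A2 = prod_emb {0..T} (\<lambda>_. borel) J2 (Pi\<^sub>E J2 E2)" "finite J2" "J2 \<subseteq> {0..T}" "\<And>r. r \<in> J2 \<Longrightarrow> E2 r \<in> sets borel"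
      using prod_algebraE[OF b(2)] by metis
    obtain n \<tau> where part: "partition_of_interval T s t (J1 \<union> J2) n \<tau>"
      by (rule partition_of_interval_exists[OF st, of "J1 \<union> J2"]) (use 1 2 in auto)
    interpret partition_of_interval T s t "J1 \<union> J2" n \<tau> by fact
    let ?\<Delta> = "\<lambda>k \<omega>. W (\<tau> (Suc k)) \<omega> - W (\<tau> k) \<omega>"
    let ?X = "\<lambda>\<omega>. \<lambda>k\<in>outer_block. ?\<Delta> k \<omega>" and ?Y = "\<lambda>\<omega>. \<lambda>k\<in>inner_block. ?\<Delta> k \<omega>"
    define S1 where "S1 = {x\<in>space (\<Pi>\<^sub>M k\<in>outer_block. (borel::(real^'d) measure)). \<forall>r\<in>J1. increment_sum \<tau> outer_block x r \<in> E1 r}"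
    define S2 where "S2 = {x\<in>space (\<Pi>\<^sub>M k\<in>inner_block. (borel::(real^'d) measure)). \<forall>r\<in>J2. increment_sum \<tau> inner_block x r \<in> E2 r}"
    have "indep_vars (\<lambda>_. borel) ?\<Delta> {..<n}"
      using BM \<tau> by (simp add: brownian_motion_def)
    then have ind: "indep_var (\<Pi>\<^sub>M k\<in>outer_block. borel) ?X (\<Pi>\<^sub>M k\<in>inner_block. borel) ?Y"
      by (rule indep_var_restrict) (auto simp: outer_block_def inner_block_def)
    have S_sets: "{x\<in>space (\<Pi>\<^sub>M k\<in>K. (borel::(real^'d) measure)). \<forall>r\<in>J. increment_sum \<tau> K x r \<in> E r} \<in> sets (\<Pi>\<^sub>M k\<in>K. borel)"
      if "finite J" "\<And>r. r \<in> J \<Longrightarrow> E r \<in> sets borel" for J :: "real set" and K E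
    proof (rule sets.sets_Collect_finite_All[OF _ that(1)])
      fix r assume "r \<in> J"
      from measurable_sets[OF increment_sum_measurable that(2)[OF this]]
      show "{x\<in>space (\<Pi>\<^sub>M k\<in>K. (borel::(real^'d) measure)). increment_sum \<tau> K x r \<in> E r} \<in> sets (\<Pi>\<^sub>M k\<in>K. borel)"
        by (simp add: vimage_def Int_def conj_commute)
    qed
    have S: "S1 \<in> sets (\<Pi>\<^sub>M k\<in>outer_block. borel)" "S2 \<in> sets (\<Pi>\<^sub>M k\<in>inner_block. borel)"
      unfolding S1_def S2_def by (rule S_sets, fact, fact)+
    have a': "a = ?X -` S1 \<inter> space M"
      unfolding a(1) 1(1) vimage_cylinder[OF path_extensional(2) 1(3)]
      by (auto simp: S1_def space_PiM outer_path_eq_increment_sum)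
    have b': "b = ?Y -` S2 \<inter> space M"
      unfolding b(1) 2(1) vimage_cylinder[OF path_extensional(1) 2(3)]
      by (auto simp: S2_def space_PiM inner_path_eq_increment_sum)
    have "a \<inter> b = (\<lambda>\<omega>. (?X \<omega>, ?Y \<omega>)) -` (S1 \<times> S2) \<inter> space M"
      unfolding a' b' by auto
    then show "prob (a \<inter> b) = prob a * prob b"
      unfolding a' b' using indep_varD[OF ind S] by simp
  qed
  from indep_set_sigma_sets[OF this stable stable]
  have ind: "indep_set {?O -` A \<inter> space M |A. A \<in> sets (path_space T)} {?I -` A \<inter> space M |A. A \<in> sets (path_space T)}"
    by (simp only: sets_eq[OF I] sets_eq[OF O])
  have "{\<omega>\<in>space M. ?O \<omega> \<in> A \<and> ?I \<omega> \<in> C} = (?O -` A \<inter> space M) \<inter> (?I -` C \<inter> space M)" by auto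
  moreover have "prob ((?O -` A \<inter> space M) \<inter> (?I -` C \<inter> space M)) = prob (?O -` A \<inter> space M) * prob (?I -` C \<inter> space M)"
    by (rule indep_setD[OF ind]) (use A C in blast)+
  ultimately have "emeasure M {\<omega>\<in>space M. ?O \<omega> \<in> A \<and> ?I \<omega> \<in> C}
      = emeasure M (?O -` A \<inter> space M) * emeasure M (?I -` C \<inter> space M)"
    by (simp add: emeasure_eq_measure ennreal_mult)
  then show ?thesis
    using emeasure_distr[OF I C] by simp
qed

section \<open>Augmented \<sigma>-algebras\<close>

lemma sets_aug_sigma:
  "sets (aug_sigma N XS) = sigma_sets (space N) ({X -` B \<inter> space N | X B. X \<in> XS \<and> B \<in> sets borel} \<union> null_sets N)"
  unfolding aug_sigma_def by (rule sets_measure_of) (use null_setsD2[of _ N] sets.sets_into_space in blast)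

lemma space_aug_sigma [simp]: "space (aug_sigma N XS) = space N"
  unfolding aug_sigma_def by (rule space_measure_of) (use null_setsD2[of _ N] sets.sets_into_space in blast)

lemma subalgebra_aug_sigma:
  assumes "\<And>X. X \<in> XS \<Longrightarrow> X \<in> borel_measurable N"
  shows "subalgebra N (aug_sigma N XS)"
  unfolding subalgebra_def sets_aug_sigma
  using measurable_sets[OF assms] by (auto intro!: sets.sigma_sets_subset)

lemma measurable_aug_sigma: "X \<in> XS \<Longrightarrow> X \<in> borel_measurable (aug_sigma N XS)"
  by (rule measurableI) (auto simp: sets_aug_sigma intro!: sigma_sets.Basic)

lemma subalgebra_aug_sigma_mono:
  assumes "\<And>X. X \<in> XS \<Longrightarrow> X \<in> borel_measurable (aug_sigma N YS)"
  shows "subalgebra (aug_sigma N YS) (aug_sigma N XS)"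
proof -
  have "{X -` B \<inter> space N | X B. X \<in> XS \<and> B \<in> sets borel} \<union> null_sets N \<subseteq> sets (aug_sigma N YS)"
    using measurable_sets[OF assms] by (auto simp: sets_aug_sigma[of N YS] intro: sigma_sets.Basic)
  then show ?thesis
    unfolding subalgebra_def sets_aug_sigma[of N XS]
    using sets.sigma_sets_subset[of _ "aug_sigma N YS"] by simp
qed

text \<open>Events of the augmented \<open>\<sigma>\<close>-algebra are, up to a null set, events described by any \<open>Z\<close> of which
the generators are almost surely functions. The sets with this property form a \<open>\<sigma>\<close>-algebra, and
null sets are described by the empty set. Thus independence of the augmented \<open>\<sigma>\<close>-algebra reduces to
independence of \<open>Z\<close>.\<close>

lemma aug_sigma_factor:
  assumes Z: "Z \<in> N \<rightarrow>\<^sub>M Q"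
    and XS: "\<And>X. X \<in> XS \<Longrightarrow> \<exists>g\<in>borel_measurable Q. AE \<eta> in N. X \<eta> = g (Z \<eta>)"
    and A: "A \<in> sets (aug_sigma N XS)"
  shows "\<exists>C\<in>sets Q. AE \<eta> in N. \<eta> \<in> A \<longleftrightarrow> Z \<eta> \<in> C"
  using A unfolding sets_aug_sigma
proof induction
  case (Basic A)
  then consider X B where "X \<in> XS" "B \<in> sets borel" "A = X -` B \<inter> space N" | "A \<in> null_sets N" by blast
  then show ?case
  proof cases
    case 1
    then obtain g where g: "g \<in> borel_measurable Q" "AE \<eta> in N. X \<eta> = g (Z \<eta>)" using XS by blast
    have "AE \<eta> in N. \<eta> \<in> A \<longleftrightarrow> Z \<eta> \<in> g -` B \<inter> space Q"
      using g(2) AE_space by eventually_elim (use measurable_space[OF Z] 1 in auto)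
    with measurable_sets[OF g(1) 1(2)] show ?thesis by blast
  next
    case 2
    from AE_not_in[OF this] have "AE \<eta> in N. \<eta> \<in> A \<longleftrightarrow> Z \<eta> \<in> {}" by eventually_elim simp
    then show ?thesis by blast
  qed
next
  case Empty
  have "AE \<eta> in N. \<eta> \<in> {} \<longleftrightarrow> Z \<eta> \<in> {}" by simp
  then show ?case by blast
next
  case (Compl A)
  then obtain C where C: "C \<in> sets Q" "AE \<eta> in N. \<eta> \<in> A \<longleftrightarrow> Z \<eta> \<in> C" by blast
  have "AE \<eta> in N. \<eta> \<in> space N - A \<longleftrightarrow> Z \<eta> \<in> space Q - C"
    using C(2) AE_space by eventually_elim (use measurable_space[OF Z] in auto)
  with sets.compl_sets[OF C(1)] show ?case by blast
next
  case (Union A)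
  then obtain C where C: "\<And>i. C i \<in> sets Q" "\<And>i. AE \<eta> in N. \<eta> \<in> A i \<longleftrightarrow> Z \<eta> \<in> C i" by metis
  then have "AE \<eta> in N. \<forall>i. \<eta> \<in> A i \<longleftrightarrow> Z \<eta> \<in> C i" by (simp add: AE_all_countable)
  then have "AE \<eta> in N. \<eta> \<in> (\<Union>i. A i) \<longleftrightarrow> Z \<eta> \<in> (\<Union>i. C i)" by eventually_elim simp
  moreover have "(\<Union>i. C i) \<in> sets Q" using C(1) by auto
  ultimately show ?case by blast
qed

lemma independent_with_law_aug_sigma:
  assumes Z: "Z \<in> N \<rightarrow>\<^sub>M Q" and I: "I \<in> N \<rightarrow>\<^sub>M \<mu>"
    and XS: "\<And>X. X \<in> XS \<Longrightarrow> X \<in> borel_measurable N"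
    and factor: "\<And>X. X \<in> XS \<Longrightarrow> \<exists>g\<in>borel_measurable Q. AE \<eta> in N. X \<eta> = g (Z \<eta>)"
    and ind: "\<And>C B. C \<in> sets Q \<Longrightarrow> B \<in> sets \<mu> \<Longrightarrow>
      emeasure N {\<eta>\<in>space N. Z \<eta> \<in> C \<and> I \<eta> \<in> B} = emeasure N (Z -` C \<inter> space N) * emeasure \<mu> B"
  shows "independent_with_law N (aug_sigma N XS) I \<mu>"
  unfolding independent_with_law_def
proof (intro conjI ballI)
  fix A B assume A: "A \<in> sets (aug_sigma N XS)" and B: "B \<in> sets \<mu>"
  obtain C where C: "C \<in> sets Q" "AE \<eta> in N. \<eta> \<in> A \<longleftrightarrow> Z \<eta> \<in> C"
    using aug_sigma_factor[OF Z factor A] by blast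
  have AN: "A \<in> sets N"
    using subalgebra_aug_sigma[OF XS] A by (auto simp: subalgebra_def)
  have "A \<inter> I -` B = A \<inter> (I -` B \<inter> space N)"
    using sets.sets_into_space[OF AN] by auto
  also have "emeasure N \<dots> = emeasure N ((Z -` C \<inter> space N) \<inter> (I -` B \<inter> space N))"
  proof (rule emeasure_eq_AE)
    show "AE \<eta> in N. \<eta> \<in> A \<inter> (I -` B \<inter> space N) \<longleftrightarrow> \<eta> \<in> (Z -` C \<inter> space N) \<inter> (I -` B \<inter> space N)"
      using C(2) by eventually_elim auto
  qed (use AN measurable_sets[OF I B] measurable_sets[OF Z C(1)] in auto)
  also have "(Z -` C \<inter> space N) \<inter> (I -` B \<inter> space N) = {\<eta>\<in>space N. Z \<eta> \<in> C \<and> I \<eta> \<in> B}" by auto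
  also have "emeasure N \<dots> = emeasure N (Z -` C \<inter> space N) * emeasure \<mu> B" by (rule ind[OF C(1) B])
  also have "emeasure N (Z -` C \<inter> space N) = emeasure N A"
  proof (rule emeasure_eq_AE)
    show "AE \<eta> in N. \<eta> \<in> Z -` C \<inter> space N \<longleftrightarrow> \<eta> \<in> A"
      using C(2) AE_space by eventually_elim auto
  qed (use AN measurable_sets[OF Z C(1)] in auto)
  finally show "emeasure N (A \<inter> I -` B) = emeasure N A * emeasure \<mu> B" .
qed (fact I)

section \<open>Haar integrals as functions of the path\<close>

lemma haar_steps_nonneg: "T > 0 \<Longrightarrow> (a, u, v) \<in> set (haar_steps T k) \<Longrightarrow> 0 \<le> u \<and> 0 \<le> v"
  by (auto simp: haar_steps_def Let_def split: if_splits)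

text \<open>A path \<open>q\<close> is itself a process on the path space, evaluated by \<open>\<lambda>r q. q r\<close>. With this reading the
same step integral is a measurable function on paths.\<close>

lemma step_integral_measurable:
  assumes "0 \<le> T" "\<And>a u v. (a, u, v) \<in> set \<psi> \<Longrightarrow> 0 \<le> u \<and> 0 \<le> v"
  shows "(\<lambda>q. step_integral \<psi> (\<lambda>r q. q r) T q) \<in> borel_measurable (path_space T :: (real \<Rightarrow> real ^ 'd) measure)"
  using assms(2)
proof (induction \<psi>)
  case (Cons c \<psi>)
  obtain a u v where c: "c = (a, u, v)" by (cases c)
  have "0 \<le> u" "0 \<le> v" using Cons.prems[of a u v] c by auto
  then have "(\<lambda>q. a *\<^sub>R (q (min v T) - q (min u T))) \<in> borel_measurable (path_space T :: (real \<Rightarrow> real ^ 'd) measure)"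
    using assms(1)
    by (intro borel_measurable_scaleR borel_measurable_const borel_measurable_diff measurable_component_singleton) auto
  moreover have "(\<lambda>q. step_integral \<psi> (\<lambda>r q. q r) T q) \<in> borel_measurable (path_space T :: (real \<Rightarrow> real ^ 'd) measure)"
    by (rule Cons.IH) (use Cons.prems in auto)
  ultimately show ?case
    by (simp add: step_integral_def c)
qed (simp add: step_integral_def[abs_def])

lemma haar_integrals_measurable:
  assumes "T > 0"
  shows "(\<lambda>q. haar_integrals T (\<lambda>r q. q r) q) \<in> path_space T \<rightarrow>\<^sub>M (\<Pi>\<^sub>M k\<in>(UNIV::nat set). borel)"
  unfolding haar_integrals_def
  using assms haar_steps_nonneg[OF assms]
  by (intro measurable_PiM_single' step_integral_measurable) (auto simp: PiE_UNIV_domain)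

lemma step_integral_increments:
  assumes "0 \<le> T" "\<And>a u v. (a, u, v) \<in> set \<psi> \<Longrightarrow> 0 \<le> u \<and> 0 \<le> v"
    and "\<And>r. r \<in> {0..T} \<Longrightarrow> q r = B r \<eta> - c"
  shows "step_integral \<psi> (\<lambda>r q. q r) T q = step_integral \<psi> B T \<eta>"
  unfolding step_integral_def
proof (intro arg_cong[where f = sum_list] map_cong refl)
  fix z assume "z \<in> set \<psi>"
  moreover obtain a u v where z: "z = (a, u, v)" by (cases z)
  ultimately have "0 \<le> u" "0 \<le> v" using assms(2)[of a u v] by auto
  then show "(case z of (a, u, v) \<Rightarrow> a *\<^sub>R (q (min v T) - q (min u T)))
      = (case z of (a, u, v) \<Rightarrow> a *\<^sub>R (B (min v T) \<eta> - B (min u T) \<eta>))"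
    using assms(1) by (simp add: z assms(3))
qed

text \<open>Haar integrals see only increments, so the initial value \<open>c\<close> drops out.\<close>

lemma haar_integrals_increments:
  assumes "T > 0" "\<And>r. r \<in> {0..T} \<Longrightarrow> q r = B r \<eta> - c"
  shows "haar_integrals T B \<eta> = haar_integrals T (\<lambda>r q. q r) q"
  unfolding haar_integrals_def using assms haar_steps_nonneg[OF assms(1)]
  by (intro ext step_integral_increments[symmetric]) auto

lemma W0_eq_paths:
  assumes "0 \<le> s" "s < t" "t \<le> T" "r \<in> {0..T}"
  shows "outer_path T s t W (fst \<eta>) r + inner_path T s t W (fst \<eta>) r = W0 W r \<eta> - W 0 (fst \<eta>)"
  using assms by (auto simp: outer_path_def inner_path_def W0_def min_def max_def)

lemma W_mixed_eq_paths:
  assumes "0 \<le> s" "s < t" "t \<le> T" "r \<in> {0..T}"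
  shows "outer_path T s t W (fst \<eta>) r + inner_path T s t W' (snd \<eta>) r = W_mixed T s t W W' r \<eta>"
  using assms
  by (auto simp: outer_path_def inner_path_def W_mixed_def step_integral_def outside_steps_def
      inside_steps_def W0_def W1_def min_def max_def)

section \<open>The inequalities for Brownian motion\<close>

lemma L0_C_sets_cong: "sets A = sets B \<Longrightarrow> L0_C A = L0_C B"
  using sets_eq_imp_space_eq[of A B] measurable_cong_sets[of A B "borel :: real measure" borel]
  unfolding L0_C_def by simp

lemma real_cond_exp_sets_cong: "sets A = sets B \<Longrightarrow> real_cond_exp N A g = real_cond_exp N B g"
  using sets_eq_imp_space_eq[of A B]
  by (simp add: real_cond_exp_def nn_cond_exp_def restr_to_subalg_def subalgebra_def)

text \<open>The weight \<open>T\<close> compensates the normalization of Lebesgue measure on \<open>[0, T]\<close>.\<close>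

lemma sup_dist_integral_eq:
  assumes T: "0 < T" and u: "0 \<le> u1" "u1 < u2" "u2 \<le> T"
    and m: "(\<lambda>r. SUP x. ennreal \<bar>g (r, \<eta>) x - h (r, \<eta>) x\<bar>) \<in> borel_measurable (restrict_space borel {0..T})"
  shows "(\<integral>\<^sup>+ r. ennreal T * indicator {u1..u2} r * (SUP x. ennreal \<bar>g (r, \<eta>) x - h (r, \<eta>) x\<bar>)
      \<partial>scale_measure (ennreal (1 / T)) (restrict_space lborel {0..T})) = sup_dist_integral u1 u2 g h \<eta>"
proof -
  let ?S = "\<lambda>r. SUP x. ennreal \<bar>g (r, \<eta>) x - h (r, \<eta>) x\<bar>" and ?L = "restrict_space lborel {0..T}"
  have sets: "sets ?L = sets (restrict_space borel {0..T})" by (simp add: sets_restrict_space)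
  have S: "?S \<in> borel_measurable ?L" using m by (simp add: measurable_cong_sets[OF sets refl])
  have i: "indicator {u1..u2} \<in> borel_measurable ?L"
    by (rule measurable_restrict_space1) simp
  have "(\<integral>\<^sup>+ r. ennreal T * indicator {u1..u2} r * ?S r \<partial>scale_measure (ennreal (1 / T)) ?L)
      = ennreal (1 / T) * (\<integral>\<^sup>+ r. ennreal T * indicator {u1..u2} r * ?S r \<partial>?L)"
    by (rule nn_integral_scale_measure) (intro borel_measurable_times_ennreal S i borel_measurable_const)
  also have "(\<integral>\<^sup>+ r. ennreal T * indicator {u1..u2} r * ?S r \<partial>?L) = ennreal T * (\<integral>\<^sup>+ r. ?S r * indicator {u1..u2} r \<partial>?L)"
    using borel_measurable_times_ennreal[OF S i] by (subst nn_integral_cmult[symmetric]) (auto simp: mult_ac)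
  also have "ennreal (1 / T) * \<dots> = (\<integral>\<^sup>+ r. ?S r * indicator {u1..u2} r \<partial>?L)"
    using T by (simp add: mult.assoc[symmetric] flip: ennreal_mult)
  also have "\<dots> = (\<integral>\<^sup>+ r. ?S r * indicator {u1..u2} r * indicator {0..T} r \<partial>lborel)"
    by (rule nn_integral_restrict_space) simp
  also have "\<dots> = sup_dist_integral u1 u2 g h \<eta>"
    unfolding sup_dist_integral_def using u by (intro nn_integral_cong) (auto simp: indicator_def)
  finally show ?thesis .
qed

lemma prob_space_normalized_interval:
  "0 < T \<Longrightarrow> prob_space (scale_measure (ennreal (1 / T)) (restrict_space lborel {0..T}))"
  by (rule prob_spaceI)
    (simp add: space_scale_measure space_restrict_space emeasure_restrict_space flip: ennreal_mult)

theorem proposition8p6: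
  fixes T p s t u1 u2 :: real
    and M :: "'a measure" and M' :: "'b measure"
    and W :: "real \<Rightarrow> 'a \<Rightarrow> real ^ 'd" and W' :: "real \<Rightarrow> 'b \<Rightarrow> real ^ 'd"
    and f f_dec f_cond :: "real \<times> 'a \<times> 'b \<Rightarrow> 'x::complete_space \<Rightarrow> real"
  defines "G \<equiv> G_bar T s t M M' W"
  assumes "T > 0"
    and "brownian_basis T M W" and "brownian_basis T M' W'"
    and "locally_sigma_compact TYPE('x)"
    and "1 \<le> p" and "0 \<le> s" "s < t" "t \<le> T" and "0 \<le> u1" "u1 < u2" "u2 \<le> T"
    and "f \<in> L0_C (time_prod T (F0 T M M' W))"
    and "\<And>K. compact K \<Longrightarrow> (\<integral>\<^sup>+ \<eta>. (SUP x\<in>K. ennreal \<bar>f \<eta> x\<bar>) \<partial>Omega_bar_T T M M') < \<infinity>"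
    and "is_decoupled_C T s t M M' W W' f f_dec"
    and "is_cond_exp_C (Omega_bar_T T M M') (time_prod T G) f f_cond"
  shows "(enn_Lp_norm p (Omega_bar M M') (sup_dist_integral u1 u2 f f_cond) < \<infinity> \<longrightarrow>
           (AE \<eta> in Omega_bar M M'.
              nn_cond_exp (Omega_bar M M') G (\<lambda>\<eta>. enn_powr (sup_dist_integral u1 u2 f f_dec \<eta>) p) \<eta>
              \<le> ennreal (2 powr p) *
                nn_cond_exp (Omega_bar M M') G (\<lambda>\<eta>. enn_powr (sup_dist_integral u1 u2 f f_cond \<eta>) p) \<eta>)) \<and>
         (enn_Lp_norm p (Omega_bar M M') (sup_dist_integral u1 u2 f f_dec) < \<infinity> \<longrightarrow>
           (AE \<eta> in Omega_bar M M'.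
              nn_cond_exp (Omega_bar M M') G (\<lambda>\<eta>. enn_powr (sup_dist_integral u1 u2 f f_cond \<eta>) p) \<eta>
              \<le> nn_cond_exp (Omega_bar M M') G (\<lambda>\<eta>. enn_powr (sup_dist_integral u1 u2 f f_dec \<eta>) p) \<eta>))"
proof -
  define N where "N = Omega_bar M M'"
  define R where "R = scale_measure (ennreal (1 / T)) (restrict_space lborel {0..T})"
  define F where "F = F0 T M M' W"
  define \<mu> where "\<mu> = distr M (path_space T) (inner_path T s t W)"
  define I0 where "I0 = (\<lambda>\<eta> :: 'a \<times> 'b. inner_path T s t W (fst \<eta>))"
  define I1 where "I1 = (\<lambda>\<eta> :: 'a \<times> 'b. inner_path T s t W' (snd \<eta>))"
  define Z where "Z = (\<lambda>\<eta> :: 'a \<times> 'b. outer_path T s t W (fst \<eta>))"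
  define w where "w = (\<lambda>r. ennreal T * indicator {u1..u2} r)"
  have st: "0 \<le> s" "s < t" "t \<le> T" and T: "0 < T" by fact+
  have M: "prob_space M" and BM: "brownian_motion T M W"
    using \<open>brownian_basis T M W\<close> by (auto simp: brownian_basis_def)
  have M': "prob_space M'" and BM': "brownian_motion T M' W'"
    using \<open>brownian_basis T M' W'\<close> by (auto simp: brownian_basis_def)
  interpret M: prob_space M by fact
  interpret M': prob_space M' by fact
  interpret MM: prob_space "M \<Otimes>\<^sub>M M'" by (rule prob_space_pair) fact+
  have N: "prob_space N"
    unfolding N_def Omega_bar_def by (rule MM.prob_space_completion)
  have R: "prob_space R" unfolding R_def by (rule prob_space_normalized_interval) fact
  have setsR: "sets R = sets (restrict_space borel {0..T})" by (simp add: R_def sets_restrict_space)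
  have Wm: "\<And>r. r \<in> {0..T} \<Longrightarrow> W r \<in> borel_measurable M" using BM by (simp add: brownian_motion_def)
  have Wm': "\<And>r. r \<in> {0..T} \<Longrightarrow> W' r \<in> borel_measurable M'" using BM' by (simp add: brownian_motion_def)
  have fstN: "fst \<in> N \<rightarrow>\<^sub>M M" and sndN: "snd \<in> N \<rightarrow>\<^sub>M M'"
    unfolding N_def Omega_bar_def by (auto intro!: measurable_completion)
  have N_Times: "emeasure N (A \<times> B) = emeasure M A * emeasure M' B" if "A \<in> sets M" "B \<in> sets M'" for A B
    using that by (simp add: N_def Omega_bar_def M'.emeasure_pair_measure_Times)
  have spaceN: "space N = space M \<times> space M'"
    by (simp add: N_def Omega_bar_def space_pair_measure)
  have N_fst: "emeasure N (fst -` A \<inter> space N) = emeasure M A" if "A \<in> sets M" for A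
  proof -
    have "fst -` A \<inter> space N = A \<times> space M'" using sets.sets_into_space[OF that] by (auto simp: spaceN)
    then show ?thesis using N_Times[OF that sets.top] by (simp add: M'.emeasure_space_1)
  qed
  have inner: "inner_path T s t W \<in> M \<rightarrow>\<^sub>M path_space T" and outer: "outer_path T s t W \<in> M \<rightarrow>\<^sub>M path_space T"
    and inner': "inner_path T s t W' \<in> M' \<rightarrow>\<^sub>M path_space T"
    by (rule path_measurable[OF Wm st] path_measurable[OF Wm' st]; assumption)+
  have I0m: "I0 \<in> N \<rightarrow>\<^sub>M \<mu>" and I1m: "I1 \<in> N \<rightarrow>\<^sub>M \<mu>" and Zm: "Z \<in> N \<rightarrow>\<^sub>M path_space T"
    unfolding I0_def I1_def Z_def \<mu>_def measurable_distr_eq2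
    using measurable_compose[OF fstN inner] measurable_compose[OF sndN inner'] measurable_compose[OF fstN outer]
    by simp_all
  have \<mu>: "prob_space \<mu>" unfolding \<mu>_def by (rule M.prob_space_distr[OF inner])
  have \<mu>': "\<mu> = distr M' (path_space T) (inner_path T s t W')"
    unfolding \<mu>_def by (rule distr_inner_path_eq[OF BM M BM' M' st])
  have W0m: "W0 W r \<in> borel_measurable N" if "r \<in> {0..T}" for r
    unfolding W0_def using measurable_compose[OF fstN Wm[OF that]] .
  define XS :: "('a \<times> 'b \<Rightarrow> real ^ 'd) set" where "XS = W0 W ` {0..s} \<union> (\<lambda>r \<eta>. W0 W r \<eta> - W0 W t \<eta>) ` {t..T}"
  have G: "G = aug_sigma N XS" by (simp add: G_def G_bar_def N_def XS_def)
  have F: "F = aug_sigma N (W0 W ` {0..T})" by (simp add: F_def F0_def N_def)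
  have XSm: "X \<in> borel_measurable N" if "X \<in> XS" for X
    using that st by (auto simp: XS_def intro!: W0m borel_measurable_diff)
  have sub_F: "subalgebra N F" unfolding F by (rule subalgebra_aug_sigma) (auto intro: W0m)
  have sub_GF: "subalgebra F G"
    unfolding F G
  proof (rule subalgebra_aug_sigma_mono)
    have W0F: "W0 W r \<in> borel_measurable (aug_sigma N (W0 W ` {0..T}))" if "r \<in> {0..T}" for r
      using that by (intro measurable_aug_sigma imageI)
    show "X \<in> borel_measurable (aug_sigma N (W0 W ` {0..T}))" if "X \<in> XS" for X
      using that st by (auto simp: XS_def intro!: W0F borel_measurable_diff)
  qed
  have Z_G: "Z \<in> G \<rightarrow>\<^sub>M path_space T"
  proof -
    have W0G: "W0 W r \<in> borel_measurable G" if "r \<in> {0..s}" for r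
      unfolding G using that by (intro measurable_aug_sigma) (auto simp: XS_def)
    have W0tG: "(\<lambda>\<eta>. W0 W r \<eta> - W0 W t \<eta>) \<in> borel_measurable G" if "r \<in> {t..T}" for r
      unfolding G using that by (intro measurable_aug_sigma) (auto simp: XS_def)
    have "(\<lambda>\<eta>. \<lambda>r\<in>{0..T}. (W0 W (min r s) \<eta> - W0 W 0 \<eta>) + (W0 W (max r t) \<eta> - W0 W t \<eta>)) \<in> G \<rightarrow>\<^sub>M path_space T"
      using st by (intro measurable_restrict borel_measurable_add borel_measurable_diff[OF W0G W0G] W0tG) auto
    then show ?thesis by (simp add: Z_def outer_path_def W0_def)
  qed
  \<comment> \<open>The generators \<open>W\<^sup>0\<^sub>r\<close> of \<open>G\<close> are recovered from the outer path only where \<open>W\<^sub>0 = 0\<close>.\<close>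
  have W0_0: "AE \<eta> in N. W 0 (fst \<eta>) = 0"
  proof -
    have "AE \<omega> in distr (M \<Otimes>\<^sub>M M') M fst. W 0 \<omega> = 0"
      unfolding M'.distr_pair_fst[of M] using BM unfolding brownian_motion_def by blast
    from AE_distrD[OF measurable_fst this] show ?thesis
      unfolding N_def Omega_bar_def by (rule AE_completion)
  qed
  \<comment> \<open>The events of \<open>G\<close> are described by the outer path of \<open>W\<close>, which is independent of the inner path.\<close>
  have indep0: "independent_with_law N G I0 \<mu>"
    unfolding G
  proof (rule independent_with_law_aug_sigma[OF Zm I0m XSm])
    fix X assume "X \<in> XS"
    then consider r where "r \<in> {0..s}" "X = W0 W r" | r where "r \<in> {t..T}" "X = (\<lambda>\<eta>. W0 W r \<eta> - W0 W t \<eta>)"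
      by (auto simp: XS_def)
    then show "\<exists>g\<in>borel_measurable (path_space T). AE \<eta> in N. X \<eta> = g (Z \<eta>)"
    proof cases
      case 1
      have "AE \<eta> in N. X \<eta> = Z \<eta> r"
        using W0_0 by eventually_elim (use 1 st in \<open>simp add: Z_def outer_path_def W0_def\<close>)
      moreover have "(\<lambda>q. q r) \<in> borel_measurable (path_space T)"
        using 1 st by (intro measurable_component_singleton) auto
      ultimately show ?thesis by (rule bexI[where P = "\<lambda>g. AE \<eta> in N. X \<eta> = g (Z \<eta>)" and x = "\<lambda>q. q r"])
    next
      case 2
      have "AE \<eta> in N. X \<eta> = Z \<eta> r - Z \<eta> t"
        using 2 st by (simp add: Z_def outer_path_def W0_def)
      moreover have "(\<lambda>q. q r - q t) \<in> borel_measurable (path_space T)"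
        using 2 st by (intro borel_measurable_diff measurable_component_singleton) auto
      ultimately show ?thesis by (rule bexI[where P = "\<lambda>g. AE \<eta> in N. X \<eta> = g (Z \<eta>)" and x = "\<lambda>q. q r - q t"])
    qed
  next
    fix C B :: "(real \<Rightarrow> real ^ 'd) set" assume C: "C \<in> sets (path_space T)" and B: "B \<in> sets \<mu>"
    then have B': "B \<in> sets (path_space T)" by (simp add: \<mu>_def)
    let ?A = "{\<omega>\<in>space M. outer_path T s t W \<omega> \<in> C \<and> inner_path T s t W \<omega> \<in> B}"
    have "?A = (outer_path T s t W -` C \<inter> space M) \<inter> (inner_path T s t W -` B \<inter> space M)" by auto
    then have A: "?A \<in> sets M"
      using measurable_sets[OF outer C] measurable_sets[OF inner B'] by auto
    have "{\<eta>\<in>space N. Z \<eta> \<in> C \<and> I0 \<eta> \<in> B} = fst -` ?A \<inter> space N"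
      by (auto simp: Z_def I0_def spaceN)
    then have "emeasure N {\<eta>\<in>space N. Z \<eta> \<in> C \<and> I0 \<eta> \<in> B} = emeasure M ?A"
      using N_fst[OF A] by simp
    also have "\<dots> = emeasure M (outer_path T s t W -` C \<inter> space M) * emeasure \<mu> B"
      unfolding \<mu>_def by (rule outer_inner_path_independent[OF BM M st C B'])
    also have "emeasure M (outer_path T s t W -` C \<inter> space M) = emeasure N (fst -` (outer_path T s t W -` C \<inter> space M) \<inter> space N)"
      by (rule N_fst[OF measurable_sets[OF outer C], symmetric])
    also have "fst -` (outer_path T s t W -` C \<inter> space M) \<inter> space N = Z -` C \<inter> space N"
      by (auto simp: Z_def spaceN)
    finally show "emeasure N {\<eta>\<in>space N. Z \<eta> \<in> C \<and> I0 \<eta> \<in> B} = emeasure N (Z -` C \<inter> space N) * emeasure \<mu> B" .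
  qed
  \<comment> \<open>The events of \<open>F\<close> are described by the first coordinate, while \<open>I1\<close> depends on the second.\<close>
  have indep1: "independent_with_law N F I1 \<mu>"
    unfolding F
  proof (rule independent_with_law_aug_sigma[OF fstN I1m])
    fix X :: "'a \<times> 'b \<Rightarrow> real ^ 'd" assume "X \<in> W0 W ` {0..T}"
    then obtain r where r: "r \<in> {0..T}" "X = W0 W r" by auto
    then show "X \<in> borel_measurable N" using W0m by simp
    have "AE \<eta> in N. X \<eta> = W r (fst \<eta>)" by (simp add: r W0_def)
    then show "\<exists>g\<in>borel_measurable M. AE \<eta> in N. X \<eta> = g (fst \<eta>)"
      by (rule bexI[where P = "\<lambda>g. AE \<eta> in N. X \<eta> = g (fst \<eta>)" and x = "W r"]) (rule Wm[OF r(1)])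
  next
    fix C B assume C: "C \<in> sets M" and B: "B \<in> sets \<mu>"
    then have B': "B \<in> sets (path_space T)" by (simp add: \<mu>_def)
    have "{\<eta>\<in>space N. fst \<eta> \<in> C \<and> I1 \<eta> \<in> B} = C \<times> (inner_path T s t W' -` B \<inter> space M')"
      using sets.sets_into_space[OF C] by (auto simp: spaceN I1_def)
    then show "emeasure N {\<eta>\<in>space N. fst \<eta> \<in> C \<and> I1 \<eta> \<in> B} = emeasure N (fst -` C \<inter> space N) * emeasure \<mu> B"
      using N_Times[OF C measurable_sets[OF inner' B']] N_fst[OF C]
      by (simp add: \<mu>' emeasure_distr[OF inner' B'])
  qed
  obtain D :: "'x set" where D: "countable D" "closure D = UNIV"
    using locally_sigma_compact_dense[OF \<open>locally_sigma_compact TYPE('x)\<close>] by blast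
  have RN: "Omega_bar_T T M M' = R \<Otimes>\<^sub>M N" by (simp add: Omega_bar_T_def R_def N_def)
  have tp: "sets (time_prod T A) = sets (R \<Otimes>\<^sub>M A)" for A :: "('a \<times> 'b) measure"
    unfolding time_prod_def by (intro sets_pair_measure_cong setsR[symmetric] refl)
  have dec: "\<exists>Xh. Xh \<in> borel_measurable (time_prod T (\<Pi>\<^sub>M k\<in>(UNIV::nat set). (borel :: (real ^ 'd) measure))) \<and>
      (AE z in R \<Otimes>\<^sub>M N. f z x = Xh (fst z, haar_integrals T (W0 W) (snd z))) \<and>
      (AE z in R \<Otimes>\<^sub>M N. f_dec z x = Xh (fst z, haar_integrals T (W_mixed T s t W W') (snd z)))" for x
    using \<open>is_decoupled_C T s t M M' W W' f f_dec\<close>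
    unfolding is_decoupled_C_def is_decoupled_def RN split_beta' by auto
  have "\<exists>Xh. \<forall>x. Xh x \<in> borel_measurable (time_prod T (\<Pi>\<^sub>M k\<in>(UNIV::nat set). (borel :: (real ^ 'd) measure))) \<and>
      (AE z in R \<Otimes>\<^sub>M N. f z x = Xh x (fst z, haar_integrals T (W0 W) (snd z))) \<and>
      (AE z in R \<Otimes>\<^sub>M N. f_dec z x = Xh x (fst z, haar_integrals T (W_mixed T s t W W') (snd z)))"
    by (rule choice[OF allI[OF dec]])
  then obtain Xh where Xh_all: "\<forall>x. Xh x \<in> borel_measurable (time_prod T (\<Pi>\<^sub>M k\<in>(UNIV::nat set). (borel :: (real ^ 'd) measure))) \<and>
      (AE z in R \<Otimes>\<^sub>M N. f z x = Xh x (fst z, haar_integrals T (W0 W) (snd z))) \<and>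
      (AE z in R \<Otimes>\<^sub>M N. f_dec z x = Xh x (fst z, haar_integrals T (W_mixed T s t W W') (snd z)))" ..
  have Xh: "Xh x \<in> borel_measurable (time_prod T (\<Pi>\<^sub>M k\<in>(UNIV::nat set). (borel :: (real ^ 'd) measure)))"
      "AE z in R \<Otimes>\<^sub>M N. f z x = Xh x (fst z, haar_integrals T (W0 W) (snd z))"
      "AE z in R \<Otimes>\<^sub>M N. f_dec z x = Xh x (fst z, haar_integrals T (W_mixed T s t W W') (snd z))" for x
    using spec[OF Xh_all, of x] by simp_all
  \<comment> \<open>\<open>\<Lambda>\<close> are the Haar integrals of a path; inserting outer plus inner path makes both fields values of \<open>\<phi>\<close>.\<close>
  define \<Lambda> where "\<Lambda> = (\<lambda>q :: real \<Rightarrow> real ^ 'd. haar_integrals T (\<lambda>r q. q r) q)"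
  define \<phi> where "\<phi> x = (\<lambda>(z, y). Xh x (fst z, \<Lambda> (\<lambda>r\<in>{0..T}. Z (snd z) r + y r)))" for x
  have \<phi>: "\<phi> x \<in> borel_measurable ((R \<Otimes>\<^sub>M G) \<Otimes>\<^sub>M \<mu>)" for x
  proof -
    have "(\<lambda>p. \<lambda>r\<in>{0..T}. Z (snd (fst p)) r + snd p r) \<in> (R \<Otimes>\<^sub>M G) \<Otimes>\<^sub>M \<mu> \<rightarrow>\<^sub>M path_space T"
    proof (intro measurable_restrict borel_measurable_add)
      fix r assume r: "r \<in> {0..T}"
      show "(\<lambda>p. Z (snd (fst p)) r) \<in> borel_measurable ((R \<Otimes>\<^sub>M G) \<Otimes>\<^sub>M \<mu>)"
        by (rule measurable_compose[OF measurable_compose[OF measurable_compose[OF measurable_fst measurable_snd] Z_G]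
            measurable_component_singleton[OF r]])
      have "snd \<in> (R \<Otimes>\<^sub>M G) \<Otimes>\<^sub>M \<mu> \<rightarrow>\<^sub>M path_space T"
        using measurable_snd[of "R \<Otimes>\<^sub>M G" \<mu>] by (simp add: \<mu>_def)
      from measurable_compose[OF this measurable_component_singleton[OF r]]
      show "(\<lambda>p. snd p r) \<in> borel_measurable ((R \<Otimes>\<^sub>M G) \<Otimes>\<^sub>M \<mu>)" .
    qed
    from measurable_compose[OF this haar_integrals_measurable[OF T]]
    have "(\<lambda>p. (fst (fst p), \<Lambda> (\<lambda>r\<in>{0..T}. Z (snd (fst p)) r + snd p r)))
        \<in> (R \<Otimes>\<^sub>M G) \<Otimes>\<^sub>M \<mu> \<rightarrow>\<^sub>M R \<Otimes>\<^sub>M (\<Pi>\<^sub>M k\<in>(UNIV::nat set). borel)"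
      unfolding \<Lambda>_def by (intro measurable_Pair measurable_compose[OF measurable_fst measurable_fst])
    moreover have "sets (R \<Otimes>\<^sub>M (\<Pi>\<^sub>M k\<in>(UNIV::nat set). (borel :: (real ^ 'd) measure)))
        = sets (time_prod T (\<Pi>\<^sub>M k\<in>(UNIV::nat set). borel))"
      unfolding time_prod_def by (intro sets_pair_measure_cong setsR refl)
    ultimately have "(\<lambda>p. (fst (fst p), \<Lambda> (\<lambda>r\<in>{0..T}. Z (snd (fst p)) r + snd p r)))
        \<in> (R \<Otimes>\<^sub>M G) \<Otimes>\<^sub>M \<mu> \<rightarrow>\<^sub>M time_prod T (\<Pi>\<^sub>M k\<in>(UNIV::nat set). borel)"
      using measurable_cong_sets by blast
    from measurable_compose[OF this Xh(1)] show ?thesis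
      by (simp add: \<phi>_def split_beta')
  qed
  have J0: "haar_integrals T (W0 W) \<eta> = \<Lambda> (\<lambda>r\<in>{0..T}. Z \<eta> r + I0 \<eta> r)" for \<eta> :: "'a \<times> 'b"
    unfolding \<Lambda>_def
    by (rule haar_integrals_increments[OF T, where c = "W 0 (fst \<eta>)"])
      (use W0_eq_paths[OF st] in \<open>simp add: Z_def I0_def\<close>)
  have J1: "haar_integrals T (W_mixed T s t W W') \<eta> = \<Lambda> (\<lambda>r\<in>{0..T}. Z \<eta> r + I1 \<eta> r)" for \<eta> :: "'a \<times> 'b"
    unfolding \<Lambda>_def
    by (rule haar_integrals_increments[OF T, where c = 0])
      (use W_mixed_eq_paths[OF st] in \<open>simp add: Z_def I1_def\<close>)
  have fL: "f \<in> L0_C (R \<Otimes>\<^sub>M F)"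
    using \<open>f \<in> L0_C (time_prod T (F0 T M M' W))\<close> by (simp add: F_def L0_C_sets_cong[OF tp])
  have cL: "f_cond \<in> L0_C (R \<Otimes>\<^sub>M G)"
    and ceq: "\<And>x. AE z in R \<Otimes>\<^sub>M N. f_cond z x = real_cond_exp (R \<Otimes>\<^sub>M N) (time_prod T G) (\<lambda>z. f z x) z"
    using \<open>is_cond_exp_C (Omega_bar_T T M M') (time_prod T G) f f_cond\<close>
    by (auto simp: is_cond_exp_C_def RN L0_C_sets_cong[OF tp])
  have dL: "f_dec \<in> L0_C (R \<Otimes>\<^sub>M N)"
  proof -
    have "W_mixed T s t W W' r \<in> borel_measurable N" if "r \<in> {0..T}" for r
    proof -
      have "(\<lambda>\<eta>. Z \<eta> r + I1 \<eta> r) \<in> borel_measurable N"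
        using measurable_compose[OF Zm measurable_component_singleton[OF that]]
          measurable_compose[OF I1m[unfolded \<mu>_def measurable_distr_eq2] measurable_component_singleton[OF that]]
        by (rule borel_measurable_add)
      then show ?thesis
        using W_mixed_eq_paths[OF st that, of W _ W'] by (simp add: Z_def I1_def)
    qed
    then have sub: "subalgebra N (F_mixed T s t M M' W W')"
      unfolding F_mixed_def N_def[symmetric] by (intro subalgebra_aug_sigma) auto
    have "f_dec \<in> L0_C (R \<Otimes>\<^sub>M F_mixed T s t M M' W W')"
      using \<open>is_decoupled_C T s t M M' W W' f f_dec\<close> by (auto simp: is_decoupled_C_def L0_C_sets_cong[OF tp])
    with sub show ?thesis by (blast intro: L0_C_mono subalgebra_times)
  qed
  have f_int: "integrable (R \<Otimes>\<^sub>M N) (\<lambda>z. f z x)" for x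
  proof (rule integrableI_bounded)
    show "(\<lambda>z. f z x) \<in> borel_measurable (R \<Otimes>\<^sub>M N)"
      using L0_C_mono[OF subalgebra_times[OF sub_F] fL] by (simp add: L0_C_def)
    show "(\<integral>\<^sup>+ z. ennreal (norm (f z x)) \<partial>(R \<Otimes>\<^sub>M N)) < \<infinity>"
      using \<open>\<And>K. compact K \<Longrightarrow> (\<integral>\<^sup>+ \<eta>. (SUP x\<in>K. ennreal \<bar>f \<eta> x\<bar>) \<partial>Omega_bar_T T M M') < \<infinity>\<close>[of "{x}"] by (simp add: RN)
  qed
  interpret decoupled_field N R \<mu> G F I0 I1 D \<phi> f f_dec f_cond w
  proof (intro decoupled_field.intro decoupled_field_axioms.intro N R \<mu> sub_F sub_GF indep0 indep1 D \<phi> fL dL cL f_int)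
    show "w \<in> borel_measurable R"
    proof -
      have "(indicator {u1..u2} :: real \<Rightarrow> ennreal) \<in> borel_measurable (restrict_space borel {0..T})"
        by (rule measurable_restrict_space1) simp
      then show ?thesis
        unfolding w_def measurable_cong_sets[OF setsR refl]
        by (intro borel_measurable_times_ennreal borel_measurable_const)
    qed
    show "AE z in R \<Otimes>\<^sub>M N. f z x = \<phi> x (z, I0 (snd z))" for x
      using Xh(2)[of x] by (simp add: \<phi>_def J0)
    show "AE z in R \<Otimes>\<^sub>M N. f_dec z x = \<phi> x (z, I1 (snd z))" for x
      using Xh(3)[of x] by (simp add: \<phi>_def J1)
    show "AE z in R \<Otimes>\<^sub>M N. f_cond z x = real_cond_exp (R \<Otimes>\<^sub>M N) (R \<Otimes>\<^sub>M G) (\<lambda>z. f z x) z" for x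
      using ceq[of x] by (simp add: real_cond_exp_sets_cong[OF tp])
  qed
  \<comment> \<open>Back from the abstract distance to the integral over \<open>(u\<^sub>1, u\<^sub>2)\<close>.\<close>
  have E: "AE \<eta> in N. nn_cond_exp N G (\<lambda>\<eta>. enn_powr (sup_dist_integral u1 u2 f h \<eta>) p) \<eta>
      = nn_cond_exp N G (\<lambda>\<eta>. enn_powr (sup_dist f h \<eta>) p) \<eta>" if h: "h \<in> L0_C (R \<Otimes>\<^sub>M N)" for h :: "real \<times> 'a \<times> 'b \<Rightarrow> 'x \<Rightarrow> real"
  proof -
    have eq: "sup_dist f h \<eta> = sup_dist_integral u1 u2 f h \<eta>" if "\<eta> \<in> space N" for \<eta>
    proof -
      have "(\<lambda>r. SUP x. ennreal \<bar>f (r, \<eta>) x - h (r, \<eta>) x\<bar>) \<in> borel_measurable R"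
        by (rule measurable_compose[OF measurable_Pair2'[OF that] SUP_measurable[OF fields_N(1) h]])
      then have "(\<lambda>r. SUP x. ennreal \<bar>f (r, \<eta>) x - h (r, \<eta>) x\<bar>) \<in> borel_measurable (restrict_space borel {0..T})"
        by (simp add: measurable_cong_sets[OF setsR refl])
      from sup_dist_integral_eq[OF T \<open>0 \<le> u1\<close> \<open>u1 < u2\<close> \<open>u2 \<le> T\<close> this]
      show ?thesis unfolding sup_dist_def unfolding w_def R_def .
    qed
    note [measurable] = sup_dist_measurable[OF fields_N(1) h]
    have [measurable]: "sup_dist_integral u1 u2 f h \<in> borel_measurable N"
      by (rule measurable_cong[THEN iffD1, OF eq sup_dist_measurable[OF fields_N(1) h]])
    show ?thesis
      by (rule NG.nn_cond_exp_cong) (auto simp: eq intro!: AE_I2)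
  qed
  have "AE \<eta> in N. nn_cond_exp N G (\<lambda>\<eta>. enn_powr (sup_dist_integral u1 u2 f f_dec \<eta>) p) \<eta>
      \<le> ennreal (2 powr p) * nn_cond_exp N G (\<lambda>\<eta>. enn_powr (sup_dist_integral u1 u2 f f_cond \<eta>) p) \<eta>"
    using cond_exp_dec_le[OF \<open>1 \<le> p\<close>] E[OF fields_N(2)] E[OF fields_N(3)] by eventually_elim simp
  moreover have "AE \<eta> in N. nn_cond_exp N G (\<lambda>\<eta>. enn_powr (sup_dist_integral u1 u2 f f_cond \<eta>) p) \<eta>
      \<le> nn_cond_exp N G (\<lambda>\<eta>. enn_powr (sup_dist_integral u1 u2 f f_dec \<eta>) p) \<eta>"
    using cond_exp_cond_le[OF \<open>1 \<le> p\<close>] E[OF fields_N(2)] E[OF fields_N(3)] by eventually_elim simp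
  ultimately show ?thesis unfolding N_def by blast
qed

end
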